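(* Let $\tau\in]0,+\infty[^n$, let $\mathcal{W}$ be the random path associated with $\kappa$ and $\tau$, with drift path $m$, and let $\mathcal{H}=\mathcal{P}(\mathcal{W})$ be its generalized Pitman transform. Assume $\overline{m}=m(1)\in\mathcal{D}_\kappa$. Then $$\lim_{\ell\rightarrow+\infty}\frac{1}{\ell}\sup_{t\in[0,\ell]}\left\Vert\mathcal{H}(t)-m^{\otimes\infty}(t)\right\Vert=0\quad\text{almost surely.}$$ Furthermore, the family of random variables $\left(\frac{\mathcal{H}(t)-m^{\otimes\infty}(t)}{\sqrt{t}}\right)_{t>0}$ converges in law as $t\rightarrow+\infty$ towards the centered Gaussian law $\mathcal{N}(0,\Gamma)$, where $\Gamma$ is the covariance matrix of the random vector $X_1(1)$ in $\mathbb{R}^n$.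
   Context: Lie-theoretic setting: $\mathfrak{g}$ is a simple finite-dimensional Lie algebra over $\mathbb{C}$ of rank $n$ with simple roots $\alpha_1,\ldots,\alpha_n$ realized in $\mathbb{R}^n$ with a scalar product $\langle\cdot,\cdot\rangle$ (norm $\|\cdot\|$) invariant under the Weyl group $\mathsf{W}$; $s_i$ is the reflection attached to $\alpha_i$; $\alpha^\vee=2\alpha/\langle\alpha,\alpha\rangle$; $\omega_1,\ldots,\omega_n$ are the fundamental weights, $P=\bigoplus_i\mathbb{Z}\omega_i$, $P_+=\bigoplus_i\mathbb{Z}_{\geq0}\omega_i$, $\mathcal{C}=\{x\in\mathbb{R}^n\mid\langle x,\alpha_i^\vee\rangle\geq0\ \forall i\}$ with interior $\mathring{\mathcal{C}}$. Littelmann paths: an elementary path is a continuous piecewise linear map $\pi:[0,1]\to\mathbb{R}^n$ with $\pi(0)=0$, $\pi(1)\in P$ and rational turning points; $\mathrm{wt}(\pi)=\pi(1)$. For a path $\eta$ on $[0,T]$ set $h_i(t)=\langle\eta(t),\alpha_i^\vee\rangle$ and $M_i=\min_{[0,T]}h_i$ (an integer for all paths considered). The root operator $\tilde f_i$ is: $\tilde f_i(\eta)=\mathbf{0}$ if $h_i(T)=M_i$, otherwise $\tilde f_i(\eta)(t)=\eta(t)-\min\{1,\inf_{s\in[t,T]}h_i(s)-M_i\}\alpha_i$. Fix $\kappa\in P_+$ and an elementary path $\pi_\kappa$ from $0$ to $\kappa$ with image in $\mathcal{C}$; $B(\pi_\kappa)$ is the finite set of all nonzero paths obtained from $\pi_\kappa$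 by applying operators $\tilde f_i$. Probability: for $\beta=\sum_i\beta_i\alpha_i\in P$ ($\beta_i\in\mathbb{Q}$) put $\tau^\beta=\prod_i\tau_i^{\beta_i}$. Let $S_\kappa(\tau)=\sum_{\pi\in B(\pi_\kappa)}\tau^{\kappa-\mathrm{wt}(\pi)}$ and $p_\pi=\tau^{\kappa-\mathrm{wt}(\pi)}/S_\kappa(\tau)$, a probability distribution on $B(\pi_\kappa)$. Set $m=\sum_{\pi}p_\pi\pi$ (pointwise sum of functions on $[0,1]$), $\overline m=m(1)$. $\mathcal{M}_\kappa$ is the set of all vectors $\overline m$ obtained when $\tau$ runs over $]0,+\infty[^n$, and $\mathcal{D}_\kappa=\mathcal{M}_\kappa\cap\mathring{\mathcal{C}}$. Let $(X_\ell)_{\ell\geq1}$ be i.i.d. random variables with values in $B(\pi_\kappa)$ and law $p$. The random path $\mathcal{W}$ is $\mathcal{W}(t)=X_1(1)+\cdots+X_{\ell-1}(1)+X_\ell(t-\ell+1)$ for $t\in[\ell-1,\ell]$, $\ell\ge 1$. Put $m^{\otimes\infty}(t)=\ell\overline m+m(t-\ell)$ with $\ell=\lfloor t\rfloor$. Generalized Pitman transform: for a path $\eta$ on $[0,+\infty[$ and a simple root $\alpha$, $\mathcal{P}_\alpha(\eta)(t)=\eta(t)-\inf_{s\in[0,t]}\langle\eta(s),\alpha^\vee\rangle\alpha$, and $\mathcal{P}=\mathcal{P}_{\alpha_{i_1}}\cdots\mathcal{P}_{\alpha_{i_r}}$ where $w_0=s_{i_1}\cdots s_{i_r}$ is a minimal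 length decomposition of the longest element $w_0$ of $\mathsf{W}$ ($\mathcal{P}$ does not depend on the decomposition chosen). *)

theory Defs
  imports "HOL-Probability.Probability"
begin

locale simple_lie_algebra = vector_space scale
  for scale :: "complex \<Rightarrow> 'g::ab_group_add \<Rightarrow> 'g" +
  fixes br :: "'g \<Rightarrow> 'g \<Rightarrow> 'g"
  assumes finite_dim: "\<exists>B. finite B \<and> span B = UNIV"
    and br_linear_right: "\<And>x. Vector_Spaces.linear scale scale (br x)"
    and br_linear_left: "\<And>y. Vector_Spaces.linear scale scale (\<lambda>x. br x y)"
    and br_alternating: "\<And>x. br x x = 0"
    and jacobi: "\<And>x y z. br x (br y z) + br y (br z x) + br z (br x y) = 0"
    and not_abelian: "\<exists>x y. br x y \<noteq> 0"
    and no_proper_ideal: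
      "\<And>I. subspace I \<Longrightarrow> (\<And>x y. y \<in> I \<Longrightarrow> br x y \<in> I) \<Longrightarrow> I = {0} \<or> I = UNIV"
begin

definition subalgebra :: "'g set \<Rightarrow> bool" where
  "subalgebra K \<longleftrightarrow> subspace K \<and> (\<forall>x\<in>K. \<forall>y\<in>K. br x y \<in> K)"

primrec lower_central :: "'g set \<Rightarrow> nat \<Rightarrow> 'g set" where
  "lower_central K 0 = K"
| "lower_central K (Suc k) = span {br x y | x y. x \<in> K \<and> y \<in> lower_central K k}"

definition cartan_subalgebra :: "'g set \<Rightarrow> bool" where
  "cartan_subalgebra H \<longleftrightarrow>
     subalgebra H \<and> (\<exists>k. lower_central H k = {0}) \<and> {x. \<forall>y\<in>H. br x y \<in> H} = H"

text \<open>Elements of the dual of \<open>H\<close> are represented by functions on the whole type;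
  only their values on \<open>H\<close> matter.\<close>

definition linear_form_on :: "'g set \<Rightarrow> ('g \<Rightarrow> complex) \<Rightarrow> bool" where
  "linear_form_on H l \<longleftrightarrow>
     (\<forall>h\<in>H. \<forall>k\<in>H. l (h + k) = l h + l k) \<and> (\<forall>c. \<forall>h\<in>H. l (scale c h) = c * l h)"

definition root_space :: "'g set \<Rightarrow> ('g \<Rightarrow> complex) \<Rightarrow> 'g set" where
  "root_space H l = {v. \<forall>h\<in>H. br h v = scale (l h) v}"

definition is_root :: "'g set \<Rightarrow> ('g \<Rightarrow> complex) \<Rightarrow> bool" where
  "is_root H l \<longleftrightarrow> linear_form_on H l \<and> (\<exists>h\<in>H. l h \<noteq> 0) \<and> root_space H l \<noteq> {0}"

text \<open>The coroot of \<open>l\<close>: the element \<open>h\<close> of \<open>[g\<^sub>l, g\<^sub>-\<^sub>l]\<close> with \<open>l h = 2\<close>.\<close>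

definition is_coroot :: "'g set \<Rightarrow> ('g \<Rightarrow> complex) \<Rightarrow> 'g \<Rightarrow> bool" where
  "is_coroot H l h \<longleftrightarrow>
     h \<in> span {br x y | x y. x \<in> root_space H l \<and> y \<in> root_space H (\<lambda>k. - l k)} \<and> l h = 2"

end

definition scalar_product :: "(real^'n \<Rightarrow> real^'n \<Rightarrow> real) \<Rightarrow> bool" where
  "scalar_product ip \<longleftrightarrow>
     bilinear ip \<and> (\<forall>x y. ip x y = ip y x) \<and> (\<forall>x. x \<noteq> 0 \<longrightarrow> ip x x > 0)"

text \<open>A realization of the roots of \<open>(g, H)\<close> in \<open>\<real>\<^sup>n\<close>, where \<open>n\<close> is the rank: \<open>\<iota>\<close> identifies
  \<open>\<real>\<^sup>n\<close> with the real span of the roots in the dual of \<open>H\<close>, \<open>ip\<close> is a scalar product invariant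
  under the Weyl group of \<open>(g, H)\<close>, and \<open>\<alpha>\<close> is the family of simple roots.  The Weyl reflection
  of a root \<open>\<beta>\<close> is \<open>x \<mapsto> x - x(h\<^sub>\<beta>) \<beta>\<close> with \<open>h\<^sub>\<beta>\<close> the coroot; the pairing \<open>x(h\<^sub>\<beta>)\<close> is real on the
  real span of the roots, so that taking \<open>Re\<close> only changes the type.\<close>

locale realized_simple_lie_algebra = simple_lie_algebra scale br
  for scale :: "complex \<Rightarrow> 'g::ab_group_add \<Rightarrow> 'g" and br :: "'g \<Rightarrow> 'g \<Rightarrow> 'g" +
  fixes H :: "'g set"
    and \<iota> :: "real^'n \<Rightarrow> 'g \<Rightarrow> complex"
    and ip :: "real^'n \<Rightarrow> real^'n \<Rightarrow> real"
    and \<alpha> :: "'n::finite \<Rightarrow> real^'n"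
  assumes cartan: "cartan_subalgebra H"
    and rank: "local.dim H = CARD('n)"
    and \<iota>_form: "\<And>x. linear_form_on H (\<iota> x)"
    and \<iota>_linear: "\<And>h. h \<in> H \<Longrightarrow> Real_Vector_Spaces.linear (\<lambda>x. \<iota> x h)"
    and \<iota>_inj: "\<And>x. (\<forall>h\<in>H. \<iota> x h = 0) \<Longrightarrow> x = 0"
    and \<iota>_roots: "\<And>l. is_root H l \<Longrightarrow> \<exists>x. \<forall>h\<in>H. \<iota> x h = l h"
    and scalar_product: "scalar_product ip"
    and weyl_invariant:
      "\<And>b h x y. is_root H (\<iota> b) \<Longrightarrow> is_coroot H (\<iota> b) h \<Longrightarrow>
         ip (x - Re (\<iota> x h) *\<^sub>R b) (y - Re (\<iota> y h) *\<^sub>R b) = ip x y"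
    and simple_inj: "inj \<alpha>"
    and simple_independent: "Real_Vector_Spaces.independent (range \<alpha>)"
    and simple_roots: "\<And>i. is_root H (\<iota> (\<alpha> i))"
    and simple_base:
      "\<And>b. is_root H (\<iota> b) \<Longrightarrow>
         \<exists>c :: 'n \<Rightarrow> nat. b = (\<Sum>i\<in>UNIV. real (c i) *\<^sub>R \<alpha> i) \<or> b = - (\<Sum>i\<in>UNIV. real (c i) *\<^sub>R \<alpha> i)"

definition coroot :: "(real^'n \<Rightarrow> real^'n \<Rightarrow> real) \<Rightarrow> real^'n \<Rightarrow> real^'n" where
  "coroot ip a = (2 / ip a a) *\<^sub>R a"

definition reflection :: "(real^'n \<Rightarrow> real^'n \<Rightarrow> real) \<Rightarrow> real^'n \<Rightarrow> real^'n \<Rightarrow> real^'n" where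
  "reflection ip a x = x - ip x (coroot ip a) *\<^sub>R a"

definition fundamental_weight ::
  "(real^'n \<Rightarrow> real^'n \<Rightarrow> real) \<Rightarrow> ('n::finite \<Rightarrow> real^'n) \<Rightarrow> 'n \<Rightarrow> real^'n" where
  "fundamental_weight ip \<alpha> i =
     (THE w. \<forall>j. ip w (coroot ip (\<alpha> j)) = (if i = j then 1 else 0))"

definition weight_combinations ::
  "(real^'n \<Rightarrow> real^'n \<Rightarrow> real) \<Rightarrow> ('n::finite \<Rightarrow> real^'n) \<Rightarrow> real set \<Rightarrow> (real^'n) set" where
  "weight_combinations ip \<alpha> R =
     {\<Sum>i\<in>UNIV. c i *\<^sub>R fundamental_weight ip \<alpha> i | c. \<forall>i. c i \<in> R}"

definition weight_lattice ::
  "(real^'n \<Rightarrow> real^'n \<Rightarrow> real) \<Rightarrow> ('n::finite \<Rightarrow> real^'n) \<Rightarrow> (real^'n) set" where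
  "weight_lattice ip \<alpha> = weight_combinations ip \<alpha> \<int>"

definition dominant_weights ::
  "(real^'n \<Rightarrow> real^'n \<Rightarrow> real) \<Rightarrow> ('n::finite \<Rightarrow> real^'n) \<Rightarrow> (real^'n) set" where
  "dominant_weights ip \<alpha> = weight_combinations ip \<alpha> \<nat>"

definition weyl_chamber ::
  "(real^'n \<Rightarrow> real^'n \<Rightarrow> real) \<Rightarrow> ('n::finite \<Rightarrow> real^'n) \<Rightarrow> (real^'n) set" where
  "weyl_chamber ip \<alpha> = {x. \<forall>i. ip x (coroot ip (\<alpha> i)) \<ge> 0}"

text \<open>The Weyl group is the set of all values of \<open>weyl_word\<close>, which maps \<open>[i\<^sub>1, \<dots>, i\<^sub>r]\<close>
  to \<open>s\<^sub>i\<^sub>1 \<circ> \<dots> \<circ> s\<^sub>i\<^sub>r\<close>.\<close>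

definition weyl_word ::
  "(real^'n \<Rightarrow> real^'n \<Rightarrow> real) \<Rightarrow> ('n::finite \<Rightarrow> real^'n) \<Rightarrow> 'n list \<Rightarrow> real^'n \<Rightarrow> real^'n" where
  "weyl_word ip \<alpha> js = foldr (\<lambda>j g. reflection ip (\<alpha> j) \<circ> g) js id"

definition weyl_length ::
  "(real^'n \<Rightarrow> real^'n \<Rightarrow> real) \<Rightarrow> ('n::finite \<Rightarrow> real^'n) \<Rightarrow> (real^'n \<Rightarrow> real^'n) \<Rightarrow> nat" where
  "weyl_length ip \<alpha> w = (LEAST k. \<exists>js. length js = k \<and> weyl_word ip \<alpha> js = w)"

definition is_longest_element ::
  "(real^'n \<Rightarrow> real^'n \<Rightarrow> real) \<Rightarrow> ('n::finite \<Rightarrow> real^'n) \<Rightarrow> (real^'n \<Rightarrow> real^'n) \<Rightarrow> bool" where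
  "is_longest_element ip \<alpha> w \<longleftrightarrow>
     w \<in> range (weyl_word ip \<alpha>) \<and>
     (\<forall>v\<in>range (weyl_word ip \<alpha>). weyl_length ip \<alpha> v \<le> weyl_length ip \<alpha> w)"

definition reduced_word_of ::
  "(real^'n \<Rightarrow> real^'n \<Rightarrow> real) \<Rightarrow> ('n::finite \<Rightarrow> real^'n) \<Rightarrow> (real^'n \<Rightarrow> real^'n) \<Rightarrow> 'n list \<Rightarrow> bool" where
  "reduced_word_of ip \<alpha> w js \<longleftrightarrow> weyl_word ip \<alpha> js = w \<and> length js = weyl_length ip \<alpha> w"

text \<open>A path on \<open>[0, T]\<close> is an element of \<open>extensional {0..T}\<close>, so that equality of functions
  is equality of paths.  In \<open>elementary_path\<close>, rationality of the turning points means that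
  these points have rational coordinates in the basis of fundamental weights; the times at which
  they are reached are arbitrary reals.  Continuity follows from piecewise linearity in the
  form stated.\<close>

definition elementary_path ::
  "(real^'n \<Rightarrow> real^'n \<Rightarrow> real) \<Rightarrow> ('n::finite \<Rightarrow> real^'n) \<Rightarrow> (real \<Rightarrow> real^'n) \<Rightarrow> bool" where
  "elementary_path ip \<alpha> \<eta> \<longleftrightarrow>
     \<eta> \<in> extensional {0..1} \<and> continuous_on {0..1} \<eta> \<and>
     \<eta> 0 = 0 \<and> \<eta> 1 \<in> weight_lattice ip \<alpha> \<and>
     (\<exists>(k::nat) (t::nat \<Rightarrow> real).
        t 0 = 0 \<and> t k = 1 \<and> (\<forall>j<k. t j < t (Suc j)) \<and>
        (\<forall>j\<le>k. \<eta> (t j) \<in> weight_combinations ip \<alpha> \<rat>) \<and>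
        (\<forall>j<k. \<forall>s\<in>{t j..t (Suc j)}.
           \<eta> s = \<eta> (t j) + ((s - t j) / (t (Suc j) - t j)) *\<^sub>R (\<eta> (t (Suc j)) - \<eta> (t j))))"

text \<open>\<open>None\<close> plays the role of the zero path.\<close>

definition root_operator ::
  "(real^'n \<Rightarrow> real^'n \<Rightarrow> real) \<Rightarrow> real \<Rightarrow> real^'n \<Rightarrow> (real \<Rightarrow> real^'n) \<Rightarrow> (real \<Rightarrow> real^'n) option" where
  "root_operator ip T a \<eta> =
     (let h = (\<lambda>t. ip (\<eta> t) (coroot ip a));
          m = (INF t\<in>{0..T}. h t)
      in if h T = m then None
         else Some (\<lambda>t\<in>{0..T}. \<eta> t - min 1 ((INF s\<in>{t..T}. h s) - m) *\<^sub>R a))"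

inductive_set littelmann_crystal ::
  "(real^'n \<Rightarrow> real^'n \<Rightarrow> real) \<Rightarrow> ('n::finite \<Rightarrow> real^'n) \<Rightarrow> (real \<Rightarrow> real^'n) \<Rightarrow> (real \<Rightarrow> real^'n) set"
  for ip \<alpha> \<pi>\<^sub>\<kappa> where
  base: "\<pi>\<^sub>\<kappa> \<in> littelmann_crystal ip \<alpha> \<pi>\<^sub>\<kappa>"
| step: "\<eta> \<in> littelmann_crystal ip \<alpha> \<pi>\<^sub>\<kappa> \<Longrightarrow> root_operator ip 1 (\<alpha> i) \<eta> = Some \<eta>' \<Longrightarrow>
         \<eta>' \<in> littelmann_crystal ip \<alpha> \<pi>\<^sub>\<kappa>"

text \<open>\<open>\<tau>\<^sup>\<beta>\<close>, computed from the coordinates of \<open>\<beta>\<close> in the basis of simple roots.\<close>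

definition root_coords :: "('n::finite \<Rightarrow> real^'n) \<Rightarrow> real^'n \<Rightarrow> 'n \<Rightarrow> real" where
  "root_coords \<alpha> b = (THE c. b = (\<Sum>i\<in>UNIV. c i *\<^sub>R \<alpha> i))"

definition tau_pow :: "('n::finite \<Rightarrow> real^'n) \<Rightarrow> real^'n \<Rightarrow> real^'n \<Rightarrow> real" where
  "tau_pow \<alpha> \<tau> b = (\<Prod>i\<in>UNIV. (\<tau> $ i) powr root_coords \<alpha> b i)"

text \<open>The highest weight \<open>\<kappa>\<close> is \<open>\<pi>\<^sub>\<kappa> 1\<close>.  Finiteness of the crystal is a theorem of Littelmann
  and is not built in; the sum would be \<open>0\<close> for an infinite crystal, and \<open>path_prob\<close> identically
  \<open>0\<close>, hence not a probability distribution.\<close>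

definition crystal_sum ::
  "(real^'n \<Rightarrow> real^'n \<Rightarrow> real) \<Rightarrow> ('n::finite \<Rightarrow> real^'n) \<Rightarrow> (real \<Rightarrow> real^'n) \<Rightarrow> real^'n \<Rightarrow> real" where
  "crystal_sum ip \<alpha> \<pi>\<^sub>\<kappa> \<tau> = (\<Sum>\<eta>\<in>littelmann_crystal ip \<alpha> \<pi>\<^sub>\<kappa>. tau_pow \<alpha> \<tau> (\<pi>\<^sub>\<kappa> 1 - \<eta> 1))"

definition path_prob ::
  "(real^'n \<Rightarrow> real^'n \<Rightarrow> real) \<Rightarrow> ('n::finite \<Rightarrow> real^'n) \<Rightarrow> (real \<Rightarrow> real^'n) \<Rightarrow> real^'n \<Rightarrow>
    (real \<Rightarrow> real^'n) \<Rightarrow> real" where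
  "path_prob ip \<alpha> \<pi>\<^sub>\<kappa> \<tau> \<eta> = tau_pow \<alpha> \<tau> (\<pi>\<^sub>\<kappa> 1 - \<eta> 1) / crystal_sum ip \<alpha> \<pi>\<^sub>\<kappa> \<tau>"

definition drift_path ::
  "(real^'n \<Rightarrow> real^'n \<Rightarrow> real) \<Rightarrow> ('n::finite \<Rightarrow> real^'n) \<Rightarrow> (real \<Rightarrow> real^'n) \<Rightarrow> real^'n \<Rightarrow>
    real \<Rightarrow> real^'n" where
  "drift_path ip \<alpha> \<pi>\<^sub>\<kappa> \<tau> =
     (\<lambda>t\<in>{0..1}. \<Sum>\<eta>\<in>littelmann_crystal ip \<alpha> \<pi>\<^sub>\<kappa>. path_prob ip \<alpha> \<pi>\<^sub>\<kappa> \<tau> \<eta> *\<^sub>R \<eta> t)"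

definition drift_set ::
  "(real^'n \<Rightarrow> real^'n \<Rightarrow> real) \<Rightarrow> ('n::finite \<Rightarrow> real^'n) \<Rightarrow> (real \<Rightarrow> real^'n) \<Rightarrow> (real^'n) set" where
  "drift_set ip \<alpha> \<pi>\<^sub>\<kappa> = {drift_path ip \<alpha> \<pi>\<^sub>\<kappa> \<tau> 1 | \<tau>. \<forall>i. \<tau> $ i > 0}"

definition dominant_drift_set ::
  "(real^'n \<Rightarrow> real^'n \<Rightarrow> real) \<Rightarrow> ('n::finite \<Rightarrow> real^'n) \<Rightarrow> (real \<Rightarrow> real^'n) \<Rightarrow> (real^'n) set" where
  "dominant_drift_set ip \<alpha> \<pi>\<^sub>\<kappa> = drift_set ip \<alpha> \<pi>\<^sub>\<kappa> \<inter> interior (weyl_chamber ip \<alpha>)"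

text \<open>The concatenation of the paths \<open>x 1, x 2, \<dots>\<close> on \<open>[0, 1]\<close>.  On \<open>[\<ell> - 1, \<ell>[\<close> one has
  \<open>\<lfloor>t\<rfloor> = \<ell> - 1\<close>; at \<open>t = \<ell>\<close> the two formulas agree because every path starts at \<open>0\<close>.\<close>

definition concat_paths :: "(nat \<Rightarrow> real \<Rightarrow> real^'n) \<Rightarrow> real \<Rightarrow> real^'n" where
  "concat_paths x t = (let k = nat \<lfloor>t\<rfloor> in (\<Sum>j=1..k. x j 1) + x (Suc k) (t - real k))"

definition periodic_drift :: "(real \<Rightarrow> real^'n) \<Rightarrow> real \<Rightarrow> real^'n" where
  "periodic_drift m t = of_int \<lfloor>t\<rfloor> *\<^sub>R m 1 + m (t - of_int \<lfloor>t\<rfloor>)"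

definition pitman ::
  "(real^'n \<Rightarrow> real^'n \<Rightarrow> real) \<Rightarrow> real^'n \<Rightarrow> (real \<Rightarrow> real^'n) \<Rightarrow> real \<Rightarrow> real^'n" where
  "pitman ip a \<eta> t = \<eta> t - (INF s\<in>{0..t}. ip (\<eta> s) (coroot ip a)) *\<^sub>R a"

definition pitman_word ::
  "(real^'n \<Rightarrow> real^'n \<Rightarrow> real) \<Rightarrow> ('n::finite \<Rightarrow> real^'n) \<Rightarrow> 'n list \<Rightarrow>
    (real \<Rightarrow> real^'n) \<Rightarrow> real \<Rightarrow> real^'n" where
  "pitman_word ip \<alpha> js = foldr (\<lambda>j g. pitman ip (\<alpha> j) \<circ> g) js id"

definition covariance_matrix :: "'w measure \<Rightarrow> ('w \<Rightarrow> real^'n) \<Rightarrow> real^'n^'n" where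
  "covariance_matrix M Y =
     (\<chi> i j. \<integral>w. (Y w $ i - (\<integral>v. Y v $ i \<partial>M)) * (Y w $ j - (\<integral>v. Y v $ j \<partial>M)) \<partial>M)"

text \<open>\<open>N\<close> is the law \<open>\<N>(0, \<Gamma>)\<close>: every linear form \<open>u\<close> has the centered normal law of variance
  \<open>u \<bullet> \<Gamma> u\<close> under \<open>N\<close>, this law being the Dirac mass at \<open>0\<close> when the variance vanishes.\<close>

definition centered_gaussian :: "real^'n^'n \<Rightarrow> (real^'n) measure \<Rightarrow> bool" where
  "centered_gaussian \<Gamma> N \<longleftrightarrow>
     prob_space N \<and> sets N = sets borel \<and>
     (\<forall>u. distr N borel (\<lambda>x. u \<bullet> x) =
        (if u \<bullet> (\<Gamma> *v u) = 0 then return borel 0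
         else density lborel (normal_density 0 (sqrt (u \<bullet> (\<Gamma> *v u))))))"

definition converges_in_law ::
  "'w measure \<Rightarrow> ('t \<Rightarrow> 'w \<Rightarrow> 'a::topological_space) \<Rightarrow> 't filter \<Rightarrow> 'a measure \<Rightarrow> bool" where
  "converges_in_law M Y F N \<longleftrightarrow>
     (\<forall>\<^sub>F t in F. Y t \<in> borel_measurable M) \<and>
     (\<forall>f :: 'a \<Rightarrow> real. continuous_on UNIV f \<and> bounded (range f) \<longrightarrow>
        ((\<lambda>t. \<integral>w. f (Y t w) \<partial>M) \<longlongrightarrow> (\<integral>x. f x \<partial>N)) F)"

end

theory Submission
  imports Defs
begin

text \<open>The drift lies in the open chamber, so by the strong law of large numbers all pairings
  \<open>\<langle>\<W>(t), \<alpha>\<^sub>i\<^sup>\<or>\<rangle>\<close> are almost surely bounded below. A Pitman transform moves such a path by a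
  bounded amount and preserves lower boundedness of the pairings, hence so does any composition of
  Pitman transforms: \<open>\<H> - \<W>\<close> is almost surely bounded. Up to this random
  constant, \<open>\<H>(t) - m\<^sup>\<otimes>\<^sup>\<infinity>(t)\<close> is the centered random walk with increments \<open>X\<^sub>l(1) - m(1)\<close> at time
  \<open>\<lfloor>t\<rfloor>\<close>, to which the law of large numbers and the central limit theorem apply. The multivariate
  central limit theorem is obtained from the one-dimensional one through characteristic functions,
  tightness, and the Stone-Weierstrass theorem.\<close>

section \<open>Pitman transforms and crystals of bounded paths\<close>

text \<open>The bound on the distance from the path to its transform is random, and its moments are
  not controlled. It therefore enters the central limit theorem through almost sure convergence:
  divided by \<open>sqrt t\<close> it tends to 0 for almost every outcome, and dominated convergence
  removes it from the characteristic functions. Since the crystal is finite, increments are bounded,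
  and Hoeffding's inequality gives both the strong law (at deviations linear in n its tails are
  summable, so Borel-Cantelli applies) and tightness (at deviations of order sqrt n its tails do not
  depend on n). The covariance matrix is a sum over the crystal of rank-one matrices built from the
  vectors v = \<eta>(1) - m(1) with weights p(\<eta>). The Gaussian limit can thus be constructed as
  the law of a combination of independent standard normals with coefficients sqrt(p(\<eta>)) v.
  Finiteness of the crystal is extracted from the hypothesis that its weights are the law of a
  random variable.\<close>

lemma pitman_dist_le:
  assumes lower: "\<And>s. 0 \<le> s \<Longrightarrow> C \<le> ip (\<eta> s) (coroot ip a)" and t: "0 \<le> t"
  shows "norm (pitman ip a \<eta> t - \<eta> t) \<le> (\<bar>C\<bar> + \<bar>ip (\<eta> 0) (coroot ip a)\<bar>) * norm a"
proof -
  define I where "I = (INF s\<in>{0..t}. ip (\<eta> s) (coroot ip a))"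
  \<comment> \<open>The infimum is trapped between \<open>C\<close> and the value at time 0, two
    bounds that do not depend on \<open>t\<close>.\<close>
  have "C \<le> I"
    unfolding I_def using t lower by (intro cINF_greatest) auto
  moreover have "I \<le> ip (\<eta> 0) (coroot ip a)"
    unfolding I_def using t lower by (intro cINF_lower bdd_belowI2[where m = C]) auto
  ultimately have "\<bar>I\<bar> \<le> \<bar>C\<bar> + \<bar>ip (\<eta> 0) (coroot ip a)\<bar>" by linarith
  moreover have "norm (pitman ip a \<eta> t - \<eta> t) = \<bar>I\<bar> * norm a"
    by (simp add: pitman_def I_def)
  ultimately show ?thesis by (simp add: mult_right_mono)
qed

lemma pitman_word_Nil [simp]: "pitman_word ip \<alpha> [] \<eta> = \<eta>"
  and pitman_word_Cons [simp]:
    "pitman_word ip \<alpha> (j # js) \<eta> = pitman ip (\<alpha> j) (pitman_word ip \<alpha> js \<eta>)"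
  by (simp_all add: pitman_word_def)

lemma pitman_word_dist_bounded:
  assumes bil: "bilinear ip"
    and lower: "\<And>i. \<exists>C. \<forall>t\<ge>0. C \<le> ip (\<eta> t) (coroot ip (\<alpha> i))"
  shows "\<exists>K. \<forall>t\<ge>0. norm (pitman_word ip \<alpha> js \<eta> t - \<eta> t) \<le> K"
proof (induction js)
  case Nil
  then show ?case by auto
next
  case (Cons j js)
  let ?\<eta> = "pitman_word ip \<alpha> js \<eta>" and ?c = "coroot ip (\<alpha> j)"
  obtain K where K: "\<And>t. 0 \<le> t \<Longrightarrow> norm (?\<eta> t - \<eta> t) \<le> K" using Cons by blast
  obtain C where C: "\<And>t. 0 \<le> t \<Longrightarrow> C \<le> ip (\<eta> t) ?c" using lower by blast
  obtain B where B: "B > 0" "\<And>x y. norm (ip x y) \<le> B * norm x * norm y"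
    using bilinear_bounded_pos[OF bil] by blast
  \<comment> \<open>A displacement of norm at most \<open>K\<close> lowers the pairing with
    \<open>?c\<close> by at most \<open>B * K * norm ?c\<close>.\<close>
  define C' where "C' = C - B * K * norm ?c"
  have C': "C' \<le> ip (?\<eta> t) ?c" if "0 \<le> t" for t
  proof -
    have "\<bar>ip (?\<eta> t - \<eta> t) ?c\<bar> \<le> B * norm (?\<eta> t - \<eta> t) * norm ?c" using B(2) by simp
    also have "\<dots> \<le> B * K * norm ?c"
      using K[OF that] B(1) by (intro mult_right_mono mult_left_mono) auto
    finally show ?thesis
      using C[OF that] bilinear_lsub[OF bil, of "?\<eta> t" "\<eta> t" ?c] by (simp add: C'_def)
  qed
  have "norm (pitman_word ip \<alpha> (j # js) \<eta> t - \<eta> t)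
      \<le> (\<bar>C'\<bar> + \<bar>ip (?\<eta> 0) ?c\<bar>) * norm (\<alpha> j) + K" if "0 \<le> t" for t
  proof -
    have "pitman_word ip \<alpha> (j # js) \<eta> t - \<eta> t = (pitman ip (\<alpha> j) ?\<eta> t - ?\<eta> t) + (?\<eta> t - \<eta> t)"
      by simp
    also have "norm \<dots> \<le> (\<bar>C'\<bar> + \<bar>ip (?\<eta> 0) ?c\<bar>) * norm (\<alpha> j) + K"
      using pitman_dist_le[of C' ip ?\<eta> "\<alpha> j", OF C' that] K[OF that] by (intro norm_triangle_mono)
    finally show ?thesis .
  qed
  then show ?case by blast
qed

text \<open>The hypothesis includes negative times because \<open>pitman\<close> and \<open>concat_paths\<close> are total
  functions of time; the random transformed path is thus measurable at every real time.\<close>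

lemma pitman_word_cong:
  assumes "\<And>s. s \<le> t \<Longrightarrow> \<eta> s = \<eta>' s"
  shows "pitman_word ip \<alpha> js \<eta> t = pitman_word ip \<alpha> js \<eta>' t"
  using assms
proof (induction js arbitrary: t)
  case (Cons j js)
  have "pitman_word ip \<alpha> js \<eta> s = pitman_word ip \<alpha> js \<eta>' s" if "s \<le> t" for s
    using that Cons.prems by (intro Cons.IH) auto
  then show ?case
    by (auto simp: pitman_def intro!: INF_cong arg_cong[where f = "\<lambda>x. x *\<^sub>R _"])
qed auto

text \<open>Boundedness is the property carried along the crystal because it passes through a root
  operator easily: if the pairing stays in [-L, L], so do both infima, and the coefficient of
  \<open>a\<close> is at most 1 + 2L in absolute value.\<close>

lemma root_operator_bounded:
  assumes bil: "bilinear ip" and "bounded (\<eta> ` {0..1})" and Some: "root_operator ip 1 a \<eta> = Some \<eta>'"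
  shows "bounded (\<eta>' ` {0..1})"
proof -
  obtain K where K: "\<And>t. t \<in> {0..1} \<Longrightarrow> norm (\<eta> t) \<le> K"
    using assms(2) unfolding bounded_iff by blast
  obtain B where B: "B > 0" "\<And>x y. norm (ip x y) \<le> B * norm x * norm y"
    using bilinear_bounded_pos[OF bil] by blast
  define h where "h t = ip (\<eta> t) (coroot ip a)" for t
  define L where "L = B * K * norm (coroot ip a)"
  have h: "\<bar>h t\<bar> \<le> L" if "t \<in> {0..1}" for t
  proof -
    have "\<bar>h t\<bar> \<le> B * norm (\<eta> t) * norm (coroot ip a)" using B(2) by (simp add: h_def)
    also have "\<dots> \<le> L" unfolding L_def
      using K[OF that] B(1) by (intro mult_right_mono mult_left_mono) auto
    finally show ?thesis .
  qed
  have \<eta>': "\<eta>' t = \<eta> t - min 1 ((INF s\<in>{t..1}. h s) - (INF s\<in>{0..1}. h s)) *\<^sub>R a" if "t \<in> {0..1}" for t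
    using Some that by (auto simp: root_operator_def h_def Let_def split: if_splits)
  have "norm (\<eta>' t) \<le> K + (1 + 2 * L) * norm a" if t: "t \<in> {0..1}" for t
  proof -
    have "\<bar>INF s\<in>{t..1}. h s\<bar> \<le> L" "\<bar>INF s\<in>{0..1}. h s\<bar> \<le> L"
      using h t by (auto intro!: cInf_abs_ge)
    then have "\<bar>min 1 ((INF s\<in>{t..1}. h s) - (INF s\<in>{0..1}. h s))\<bar> \<le> 1 + 2 * L" by linarith
    then have "norm (min 1 ((INF s\<in>{t..1}. h s) - (INF s\<in>{0..1}. h s)) *\<^sub>R a) \<le> (1 + 2 * L) * norm a"
      by (simp add: mult_right_mono)
    then show ?thesis
      unfolding \<eta>'[OF t] using K[OF t] norm_triangle_ineq4 by (meson add_mono order_trans)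
  qed
  then show ?thesis unfolding bounded_iff by blast
qed

lemma littelmann_crystal_bounded:
  assumes "bilinear ip" and "bounded (\<pi> ` {0..1})" and "\<eta> \<in> littelmann_crystal ip \<alpha> \<pi>"
  shows "bounded (\<eta> ` {0..1})"
  using assms(3) by induction (use assms root_operator_bounded in blast)+

text \<open>A short step from \<open>x\<close> in direction -\<alpha>(i) stays in the chamber but
  lowers the pairing by twice the step size \<open>d\<close>, so the pairing was at least 2d. The
  choice of \<open>d\<close> makes the displacement have norm exactly \<open>e\<close>.\<close>

lemma interior_weyl_chamber_pos:
  assumes sp: "scalar_product ip" and nz: "\<alpha> i \<noteq> 0" and x: "x \<in> interior (weyl_chamber ip \<alpha>)"
  shows "ip x (coroot ip (\<alpha> i)) > 0"
proof -
  have bil: "bilinear ip" and pos: "ip (\<alpha> i) (\<alpha> i) > 0"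
    using sp nz by (auto simp: scalar_product_def)
  obtain e where e: "e > 0" "cball x e \<subseteq> weyl_chamber ip \<alpha>"
    using x by (meson mem_interior_cball)
  define d where "d = e / norm (\<alpha> i)"
  have d: "d > 0" using e nz by (simp add: d_def)
  have "x - d *\<^sub>R \<alpha> i \<in> cball x e"
    using nz e by (simp add: d_def dist_norm)
  then have "ip (x - d *\<^sub>R \<alpha> i) (coroot ip (\<alpha> i)) \<ge> 0"
    using e(2) unfolding weyl_chamber_def by blast
  moreover have "ip (\<alpha> i) (coroot ip (\<alpha> i)) = 2"
    using pos by (simp add: coroot_def bilinear_rmul[OF bil])
  ultimately show ?thesis
    using d by (simp add: bilinear_lsub[OF bil] bilinear_lmul[OF bil])
qed

section \<open>Sums of bounded independent random vectors\<close>

text \<open>Serves to pass from paths numbered from 1 to increments numbered from 0. Injectivity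
  allows a choice of events over \<open>J\<close> to be read as a choice over its image.\<close>

lemma (in prob_space) indep_vars_reindex:
  assumes "indep_vars M' X (f ` I)" and "inj_on f I"
  shows "indep_vars (\<lambda>i. M' (f i)) (\<lambda>i. X (f i)) I"
  unfolding indep_vars_def2
proof (intro conjI ballI indep_setsI)
  let ?F = "\<lambda>j. {X j -` A \<inter> space M |A. A \<in> sets (M' j)}"
  have rv: "\<And>i. i \<in> I \<Longrightarrow> random_variable (M' (f i)) (X (f i))" and ind: "indep_sets ?F (f ` I)"
    using assms(1) by (auto simp: indep_vars_def2)
  then show "\<And>i. i \<in> I \<Longrightarrow> random_variable (M' (f i)) (X (f i))" by blast
  show "?F (f i) \<subseteq> events" if "i \<in> I" for i using rv[OF that] by (auto intro: measurable_sets)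
  fix A J assume J: "J \<noteq> {}" "J \<subseteq> I" "finite J" and A: "\<forall>j\<in>J. A j \<in> ?F (f j)"
  have inj: "inj_on f J" using assms(2) J(2) by (rule inj_on_subset)
  define A' where "A' = (\<lambda>k. A (inv_into J f k))"
  have A': "A' (f j) = A j" if "j \<in> J" for j
    using that inj by (simp add: A'_def)
  have "prob (\<Inter>k\<in>f ` J. A' k) = (\<Prod>k\<in>f ` J. prob (A' k))"
    by (rule indep_setsD[OF ind]) (use J A A' in auto)
  then show "prob (\<Inter>j\<in>J. A j) = (\<Prod>j\<in>J. prob (A j))"
    using A' by (simp add: prod.reindex[OF inj])
qed

text \<open>Hoeffding's inequality for values in [-C, C]: each interval has width 2C, so the squared
  widths add up to \<open>4 * n * C\<^sup>2\<close>.\<close>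

lemma (in prob_space) bounded_sum_tail:
  fixes Y :: "nat \<Rightarrow> 'a \<Rightarrow> real"
  assumes indep: "indep_vars (\<lambda>_. borel) Y UNIV"
    and bound: "\<And>i. AE x in M. \<bar>Y i x\<bar> \<le> C" and C: "C > 0"
    and mean: "\<And>i. expectation (Y i) = 0"
    and \<epsilon>: "\<epsilon> \<ge> 0" and n: "n > 0"
  shows "prob {x \<in> space M. \<epsilon> \<le> \<bar>\<Sum>i<n. Y i x\<bar>} \<le> 2 * exp (- (\<epsilon>\<^sup>2 / (2 * C\<^sup>2 * n)))"
proof -
  interpret Hoeffding_ineq M "{..<n}" Y "\<lambda>_. -C" "\<lambda>_. C" "\<Sum>i<n. expectation (Y i)"
  proof unfold_locales
    show "indep_vars (\<lambda>_. borel) Y {..<n}" using indep indep_vars_subset by blast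
    show "AE x in M. Y i x \<in> {- C..C}" if "i \<in> {..<n}" for i
      using bound[of i] by eventually_elim auto
  qed auto
  have "(\<Sum>i<n. (C - - C)\<^sup>2) > 0" using C n by (intro sum_pos) auto
  from Hoeffding_ineq_abs_ge[OF \<epsilon> this] show ?thesis
    using n C by (simp add: mean power2_eq_square field_simps)
qed

lemma (in prob_space) bounded_strong_law_real:
  fixes Y :: "nat \<Rightarrow> 'a \<Rightarrow> real"
  assumes indep: "indep_vars (\<lambda>_. borel) Y UNIV"
    and bound: "\<And>i. AE x in M. \<bar>Y i x\<bar> \<le> C" and C: "C > 0"
    and mean: "\<And>i. expectation (Y i) = 0"
  shows "AE x in M. (\<lambda>n. (\<Sum>i<n. Y i x) / n) \<longlonglongrightarrow> 0"
proof -
  have [measurable]: "Y i \<in> borel_measurable M" for i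
    using indep by (auto simp: indep_vars_def)
  have ev: "AE x in M. eventually (\<lambda>n. \<bar>(\<Sum>i<n. Y i x) / n\<bar> < e) sequentially" if e: "e > 0" for e
  proof -
    \<comment> \<open>At deviation \<open>n * e\<close> the Hoeffding exponent is linear in
      \<open>n\<close>, so the tails are dominated by a geometric series of ratio
      \<open>q\<close>.\<close>
    define q where "q = exp (- (e\<^sup>2 / (2 * C\<^sup>2)))"
    have q: "0 < q" "q < 1" using e C by (auto simp: q_def)
    define A where "A n = {x \<in> space M. real n * e \<le> \<bar>\<Sum>i<n. Y i x\<bar>}" for n
    have [measurable]: "A n \<in> sets M" for n unfolding A_def by measurable
    have A: "prob (A n) \<le> 2 * q ^ n" for n
    proof (cases "n = 0")
      case False
      have "prob (A n) \<le> 2 * exp (- ((real n * e)\<^sup>2 / (2 * C\<^sup>2 * n)))"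
        unfolding A_def using False e by (intro bounded_sum_tail[OF indep bound C mean]) auto
      also have "(real n * e)\<^sup>2 / (2 * C\<^sup>2 * n) = real n * (e\<^sup>2 / (2 * C\<^sup>2))"
        using False by (simp add: power2_eq_square field_simps)
      finally show ?thesis by (simp add: q_def flip: exp_of_nat_mult)
    next
      \<comment> \<open>The Hoeffding bound is available for positive \<open>n\<close>; at 0 the
        trivial bound 1 is below \<open>2 * q ^ 0\<close>.\<close>
      case True
      have "prob (A n) \<le> 1" by simp
      then show ?thesis using True by (simp del: prob_le_1)
    qed
    have "summable (\<lambda>n. prob (A n))"
    proof (rule summable_comparison_test')
      show "summable (\<lambda>n. 2 * q ^ n)" using q by (intro summable_mult summable_geometric) auto
    qed (use A in auto)
    then have "AE x in M. eventually (\<lambda>n. x \<in> space M - A n) sequentially"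
      by (intro borel_cantelli_AE1) (auto simp: emeasure_eq_measure)
    then show ?thesis
    proof eventually_elim
      case (elim x)
      with eventually_gt_at_top[of 0] show ?case
        by eventually_elim (auto simp: A_def field_simps)
    qed
  qed
  \<comment> \<open>Countably many thresholds are enough, and their exceptional null sets can be
    united.\<close>
  have "AE x in M. \<forall>k. eventually (\<lambda>n. \<bar>(\<Sum>i<n. Y i x) / n\<bar> < 1 / real (Suc k)) sequentially"
    unfolding AE_all_countable by (intro allI ev) auto
  then show ?thesis
  proof eventually_elim
    case (elim x)
    show ?case
    proof (rule tendstoI)
      fix e :: real assume "e > 0"
      then obtain k where "1 / real (Suc k) < e" using nat_approx_posE by blast
      from elim[rule_format, of k] show "eventually (\<lambda>n. dist ((\<Sum>i<n. Y i x) / n) 0 < e) sequentially"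
        by eventually_elim (use \<open>1 / real (Suc k) < e\<close> in auto)
    qed
  qed
qed

text \<open>Both parts reduce to coordinates in the standard basis, where the scalar results apply;
  the second uses a union bound over the basis.\<close>

lemma (in prob_space)
  fixes Y :: "nat \<Rightarrow> 'a \<Rightarrow> 'b::euclidean_space"
  assumes indep: "indep_vars (\<lambda>_. borel) Y UNIV"
    and bound: "\<And>i. AE x in M. norm (Y i x) \<le> C" and C: "C > 0"
    and mean: "\<And>i. expectation (Y i) = 0"
  shows bounded_strong_law: "AE x in M. (\<lambda>n. (\<Sum>i<n. Y i x) /\<^sub>R n) \<longlonglongrightarrow> 0"
    and bounded_sum_tight: "e > 0 \<Longrightarrow>
      \<exists>R. \<forall>n>0. prob {x \<in> space M. norm ((\<Sum>i<n. Y i x) /\<^sub>R sqrt n) > R} \<le> e"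
proof -
  have [measurable]: "Y i \<in> borel_measurable M" for i
    using indep by (auto simp: indep_vars_def)
  have int: "integrable M (Y i)" for i by (rule integrable_const_bound[OF bound]) simp
  have comp_indep: "indep_vars (\<lambda>_. borel) (\<lambda>i x. Y i x \<bullet> b) UNIV" for b
    using indep_vars_compose2[OF indep, of "\<lambda>_ y. y \<bullet> b" "\<lambda>_. borel"] by simp
  have comp_bound: "AE x in M. \<bar>Y i x \<bullet> b\<bar> \<le> C" if "b \<in> Basis" for b i
    using bound[of i] by eventually_elim (use that Basis_le_norm order_trans in blast)
  have comp_mean: "expectation (\<lambda>x. Y i x \<bullet> b) = 0" for b i
    using int mean by simp
  have "AE x in M. \<forall>b\<in>Basis. (\<lambda>n. (\<Sum>i<n. Y i x \<bullet> b) / n) \<longlonglongrightarrow> 0"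
    by (rule AE_finite_allI)
      (use bounded_strong_law_real[OF comp_indep comp_bound C comp_mean] in auto)
  then show "AE x in M. (\<lambda>n. (\<Sum>i<n. Y i x) /\<^sub>R n) \<longlonglongrightarrow> 0"
  proof eventually_elim
    case (elim x)
    then show ?case
      by (intro tendsto_componentwise_iff[THEN iffD2])
        (auto simp: inner_sum_left divide_inverse mult.commute)
  qed
  show "\<exists>R. \<forall>n>0. prob {x \<in> space M. norm ((\<Sum>i<n. Y i x) /\<^sub>R sqrt n) > R} \<le> e" if "e > 0"
  proof -
    define d where "d = real DIM('b)"
    have d: "d > 0" by (simp add: d_def)
    \<comment> \<open>This is the bound obtained from \<open>d\<close> coordinate tails at level
      \<open>R / d * sqrt n\<close>: the factor \<open>n\<close> cancels in the Hoeffding exponent,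
      so one \<open>R\<close> serves all \<open>n\<close>. The level \<open>R / d\<close> makes the
      l1 norm, and hence the norm, at most \<open>R * sqrt n\<close> off the tail events.\<close>
    have "((\<lambda>R. d * (2 * exp (- ((R / d)\<^sup>2 / (2 * C\<^sup>2))))) \<longlongrightarrow> 0) at_top"
    proof -
      have "filterlim (\<lambda>R. (1 / (2 * C\<^sup>2 * d\<^sup>2)) * R\<^sup>2) at_top at_top"
        using C d by (intro filterlim_tendsto_pos_mult_at_top[OF tendsto_const] filterlim_pow_at_top)
          (auto simp: filterlim_ident)
      then have "((\<lambda>R. exp (- (1 / (2 * C\<^sup>2 * d\<^sup>2) * R\<^sup>2))) \<longlongrightarrow> 0) at_top"
        by (intro filterlim_compose[OF exp_at_bot] filterlim_uminus_at_top[THEN iffD1])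
      from tendsto_mult_right_zero[OF this, of "2 * d"] show ?thesis
        by (simp add: power_divide mult_ac)
    qed
    then have "eventually (\<lambda>R. d * (2 * exp (- ((R / d)\<^sup>2 / (2 * C\<^sup>2)))) < e) at_top"
      by (rule order_tendstoD) fact
    then have "eventually (\<lambda>R. R \<ge> 0 \<and> d * (2 * exp (- ((R / d)\<^sup>2 / (2 * C\<^sup>2)))) < e) at_top"
      using eventually_ge_at_top by eventually_elim auto
    then obtain R where R: "R \<ge> 0" "d * (2 * exp (- ((R / d)\<^sup>2 / (2 * C\<^sup>2)))) < e"
      unfolding eventually_at_top_linorder by blast
    have "prob {x \<in> space M. norm ((\<Sum>i<n. Y i x) /\<^sub>R sqrt n) > R} \<le> e" if n: "n > 0" for n
    proof -
      define A where "A b = {x \<in> space M. R / d * sqrt n \<le> \<bar>\<Sum>i<n. Y i x \<bullet> b\<bar>}" for b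
      have [measurable]: "A b \<in> sets M" for b unfolding A_def by measurable
      have "{x \<in> space M. norm ((\<Sum>i<n. Y i x) /\<^sub>R sqrt n) > R} \<subseteq> (\<Union>b\<in>Basis. A b)"
      proof
        fix x assume x: "x \<in> {x \<in> space M. norm ((\<Sum>i<n. Y i x) /\<^sub>R sqrt n) > R}"
        show "x \<in> (\<Union>b\<in>Basis. A b)"
        proof (rule ccontr)
          assume "x \<notin> (\<Union>b\<in>Basis. A b)"
          then have *: "\<bar>(\<Sum>i<n. Y i x) \<bullet> b\<bar> < R / d * sqrt n" if "b \<in> Basis" for b
            using x that by (auto simp: A_def inner_sum_left)
          have "norm (\<Sum>i<n. Y i x) \<le> (\<Sum>b\<in>Basis. \<bar>(\<Sum>i<n. Y i x) \<bullet> b\<bar>)" by (rule norm_le_l1)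
          also have "\<dots> \<le> (\<Sum>b\<in>(Basis::'b set). R / d * sqrt n)"
            using * by (intro sum_mono) (auto intro: less_imp_le)
          also have "\<dots> = R * sqrt n" using d by (simp add: d_def)
          finally show False using x n by (auto simp: field_simps)
        qed
      qed
      then have "prob {x \<in> space M. norm ((\<Sum>i<n. Y i x) /\<^sub>R sqrt n) > R} \<le> prob (\<Union>b\<in>Basis. A b)"
        by (intro finite_measure_mono) auto
      also have "\<dots> \<le> (\<Sum>b\<in>Basis. prob (A b))"
        by (intro finite_measure_subadditive_finite) auto
      also have "\<dots> \<le> (\<Sum>b\<in>(Basis::'b set). 2 * exp (- ((R / d)\<^sup>2 / (2 * C\<^sup>2))))"
      proof (rule sum_mono)
        fix b :: 'b assume b: "b \<in> Basis"
        have "prob (A b) \<le> 2 * exp (- ((R / d * sqrt n)\<^sup>2 / (2 * C\<^sup>2 * n)))"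
          unfolding A_def
          by (rule bounded_sum_tail[OF comp_indep comp_bound[OF b] C comp_mean]) (use R d n in auto)
        also have "(R / d * sqrt n)\<^sup>2 / (2 * C\<^sup>2 * n) = (R / d)\<^sup>2 / (2 * C\<^sup>2)"
          using n by (simp add: power_mult_distrib power_divide)
        finally show "prob (A b) \<le> 2 * exp (- ((R / d)\<^sup>2 / (2 * C\<^sup>2)))" .
      qed
      also have "\<dots> \<le> e" using R by (simp add: d_def)
      finally show ?thesis .
    qed
    then show ?thesis by blast
  qed
qed

text \<open>Turns an asymptotic statement into an inequality for every \<open>n\<close>, the
  finitely many early terms being absorbed in \<open>A\<close>. It makes the fluctuations of the
  walk comparable with the linear growth of the drift at all times.\<close>

lemma sublinear_bound:
  fixes a :: "nat \<Rightarrow> real" and e :: real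
  assumes "(\<lambda>n. a n / n) \<longlonglongrightarrow> 0" and "e > 0"
  shows "\<exists>A. \<forall>n. a n \<le> e * n + A"
proof -
  obtain k where k: "\<And>n. n \<ge> k \<Longrightarrow> a n / n < e"
    using order_tendstoD(2)[OF assms(1), of e] assms(2) by (auto simp: eventually_sequentially)
  \<comment> \<open>The term at 0 is added separately: \<open>k\<close> may be 0, and the hypothesis
    says nothing about \<open>a 0\<close> because division by 0 yields 0.\<close>
  have "a n \<le> e * n + (\<bar>a 0\<bar> + (\<Sum>i<k. \<bar>a i\<bar>))" for n
  proof (cases "n < k \<or> n = 0")
    case True
    moreover have "\<bar>a n\<bar> \<le> (\<Sum>i<k. \<bar>a i\<bar>)" if "n < k"
      using that by (intro member_le_sum) auto
    moreover have "e * n \<ge> 0" using assms by simp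
    moreover have "(\<Sum>i<k. \<bar>a i\<bar>) \<ge> 0" by (rule sum_nonneg) simp
    ultimately show ?thesis by (cases "n < k") auto
  next
    case False
    then have "a n \<le> e * n" using k[of n] by (simp add: field_simps)
    moreover have "(\<Sum>i<k. \<bar>a i\<bar>) \<ge> 0" by (rule sum_nonneg) simp
    ultimately show ?thesis by linarith
  qed
  then show ?thesis by blast
qed

section \<open>Convergence in law via characteristic functions\<close>

text \<open>The complex span of the characters: the functions whose expectations are finite linear
  combinations of values of the characteristic function. Closure under products is derived below
  from the multiplicativity of characters.\<close>

inductive trig_polynomial :: "('a::real_inner \<Rightarrow> complex) \<Rightarrow> bool" where
  exp: "trig_polynomial (\<lambda>x. iexp (u \<bullet> x))"
| cmult: "trig_polynomial f \<Longrightarrow> trig_polynomial (\<lambda>x. c * f x)"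
| add: "trig_polynomial f \<Longrightarrow> trig_polynomial g \<Longrightarrow> trig_polynomial (\<lambda>x. f x + g x)"

lemma trig_polynomial_const: "trig_polynomial (\<lambda>_. c)"
  using trig_polynomial.cmult[OF trig_polynomial.exp[of 0], of c] by simp

lemma trig_polynomial_sum:
  "finite A \<Longrightarrow> (\<And>i. i \<in> A \<Longrightarrow> trig_polynomial (f i)) \<Longrightarrow> trig_polynomial (\<lambda>x. \<Sum>i\<in>A. f i x)"
  by (induction A rule: finite_induct) (auto intro: trig_polynomial.add trig_polynomial_const)

lemma trig_polynomial_exp_mult:
  "trig_polynomial g \<Longrightarrow> trig_polynomial (\<lambda>x. iexp (u \<bullet> x) * g x)"
proof (induction rule: trig_polynomial.induct)
  case (exp v)
  have "iexp (u \<bullet> x) * iexp (v \<bullet> x) = iexp ((u + v) \<bullet> x)" for x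
    by (simp add: inner_add_left distrib_left exp_add)
  then show ?case by (simp only: trig_polynomial.exp)
next
  case (cmult f c)
  then show ?case using trig_polynomial.cmult[of "\<lambda>x. iexp (u \<bullet> x) * f x" c]
    by (simp add: mult_ac)
next
  case (add f g)
  then show ?case by (simp add: distrib_left trig_polynomial.add)
qed

lemma trig_polynomial_mult:
  "trig_polynomial f \<Longrightarrow> trig_polynomial g \<Longrightarrow> trig_polynomial (\<lambda>x. f x * g x)"
  by (induction rule: trig_polynomial.induct)
    (auto simp: distrib_right mult.assoc intro: trig_polynomial_exp_mult trig_polynomial.intros)

lemma trig_polynomial_sin: "trig_polynomial (\<lambda>x. complex_of_real (sin (u \<bullet> x)))"
proof -
  have "trig_polynomial (\<lambda>x. (- \<i> / 2) * iexp (u \<bullet> x) + (\<i> / 2) * iexp ((- u) \<bullet> x))"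
    by (intro trig_polynomial.intros)
  also have "(\<lambda>x. (- \<i> / 2) * iexp (u \<bullet> x) + (\<i> / 2) * iexp ((- u) \<bullet> x)) =
      (\<lambda>x. complex_of_real (sin (u \<bullet> x)))"
    by (auto simp: fun_eq_iff complex_eq_iff Re_exp Im_exp)
  finally show ?thesis .
qed

text \<open>Linear forms become combinations of sines, and the remaining ways to build a polynomial
  preserve trigonometric polynomials. Polynomial approximants on a cube thereby pull back to the
  whole space.\<close>

lemma trig_polynomial_of_polynomial_sin:
  fixes p :: "'a::euclidean_space \<Rightarrow> real"
  assumes "real_polynomial_function p"
  shows "trig_polynomial (\<lambda>x. complex_of_real (p (\<Sum>b\<in>Basis. sin ((c *\<^sub>R b) \<bullet> x) *\<^sub>R b)))"
  using assms
proof induction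
  case (linear f)
  have "f (\<Sum>b\<in>Basis. sin ((c *\<^sub>R b) \<bullet> x) *\<^sub>R b) = (\<Sum>b\<in>Basis. f b * sin ((c *\<^sub>R b) \<bullet> x))" for x
    using linear by (simp add: bounded_linear.linear linear_sum linear_cmul mult.commute)
  moreover have "trig_polynomial (\<lambda>x::'a. \<Sum>b\<in>Basis. complex_of_real (f b) * complex_of_real (sin ((c *\<^sub>R b) \<bullet> x)))"
    by (intro trig_polynomial_sum trig_polynomial.cmult trig_polynomial_sin) simp
  ultimately show ?case by simp
qed (auto intro: trig_polynomial_const trig_polynomial.add trig_polynomial_mult)

lemma trig_polynomial_continuous_bounded:
  assumes "trig_polynomial f"
  shows "continuous_on UNIV f" and "bounded (range f)"
proof -
  show "continuous_on UNIV f"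
    using assms by induction (auto intro!: continuous_intros)
  have "\<exists>B. \<forall>x. norm (f x) \<le> B"
    using assms
  proof induction
    case (exp u)
    then show ?case by (intro exI[of _ 1]) (simp del: of_real_mult)
  next
    case (cmult f c)
    then obtain B where "\<And>x. norm (f x) \<le> B" by blast
    then show ?case by (intro exI[of _ "norm c * B"]) (simp add: norm_mult mult_left_mono)
  next
    case (add f g)
    then obtain B B' where "\<And>x. norm (f x) \<le> B" "\<And>x. norm (g x) \<le> B'" by blast
    then show ?case by (intro exI[of _ "B + B'"]) (simp add: norm_triangle_mono)
  qed
  then show "bounded (range f)" by (auto simp: bounded_iff)
qed

lemma (in prob_space) integrable_trig_polynomial:
  fixes f :: "'b::euclidean_space \<Rightarrow> complex"
  assumes "trig_polynomial f" and [measurable]: "Z \<in> borel_measurable M"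
  shows "integrable M (\<lambda>x. f (Z x))"
proof -
  have [measurable]: "f \<in> borel_measurable borel"
    using trig_polynomial_continuous_bounded(1)[OF assms(1)] by (rule borel_measurable_continuous_onI)
  obtain B where "\<And>x. norm (f x) \<le> B"
    using trig_polynomial_continuous_bounded(2)[OF assms(1)] by (auto simp: bounded_iff)
  then show ?thesis by (intro integrable_const_bound[where B = B]) auto
qed

lemma trig_polynomial_expectation_tendsto:
  fixes Y :: "'t \<Rightarrow> 'a \<Rightarrow> 'b::euclidean_space"
  assumes "trig_polynomial f" and M: "prob_space M" and N: "prob_space N" "sets N = sets borel"
    and meas: "\<forall>\<^sub>F t in F. Y t \<in> borel_measurable M"
    and char: "\<And>u. ((\<lambda>t. CLINT x|M. iexp (u \<bullet> Y t x)) \<longlongrightarrow> (CLINT x|N. iexp (u \<bullet> x))) F"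
  shows "((\<lambda>t. CLINT x|M. f (Y t x)) \<longlongrightarrow> (CLINT x|N. f x)) F"
  using assms(1)
proof induction
  case (add f g)
  have id: "(\<lambda>x. x) \<in> borel_measurable N" by (simp add: N(2) cong: measurable_cong_sets)
  \<comment> \<open>Additivity of the integral needs measurability of \<open>Y t\<close>, which is
    available only eventually along \<open>F\<close>.\<close>
  have "\<forall>\<^sub>F t in F. (CLINT x|M. f (Y t x) + g (Y t x)) = (CLINT x|M. f (Y t x)) + (CLINT x|M. g (Y t x))"
    using meas
    by eventually_elim
      (intro Bochner_Integration.integral_add prob_space.integrable_trig_polynomial[OF M] add)
  moreover have "(CLINT x|N. f x + g x) = (CLINT x|N. f x) + (CLINT x|N. g x)"
    by (intro Bochner_Integration.integral_add prob_space.integrable_trig_polynomial[OF N(1) _ id] add)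
  ultimately show ?case
    using tendsto_add[OF add.IH] by (simp add: tendsto_cong)
qed (auto intro: char tendsto_mult_left)

text \<open>Substituting \<open>x\<^sub>b \<mapsto> sin (c x\<^sub>b)\<close> in a polynomial approximation of \<open>f\<close> read in the coordinates
  \<open>arcsin y\<^sub>b / c\<close> gives a trigonometric polynomial that is close to \<open>f\<close> on a large ball and obeys
  the bound of \<open>f\<close> everywhere.\<close>

lemma trig_polynomial_approximation:
  fixes f :: "'a::euclidean_space \<Rightarrow> real"
  assumes f: "continuous_on UNIV f" and B: "\<And>x. \<bar>f x\<bar> \<le> B" and R: "R > 0" and d: "d > 0"
  obtains q where "trig_polynomial (\<lambda>x. complex_of_real (q x))"
    and "\<And>x. norm x \<le> R \<Longrightarrow> \<bar>f x - q x\<bar> \<le> d" and "\<And>x. \<bar>f x - q x\<bar> \<le> d + 2 * B"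
proof -
  \<comment> \<open>With this scale, a vector of norm at most \<open>R\<close> has all its
    coordinates sent to [-pi/2, pi/2], where \<open>arcsin\<close> inverts
    \<open>sin\<close>.\<close>
  define c where "c = pi / (2 * R)"
  have c: "c > 0" using R by (simp add: c_def)
  define S where "S x = (\<Sum>b\<in>Basis. sin ((c *\<^sub>R b) \<bullet> x) *\<^sub>R b)" for x :: 'a
  define A where "A y = (\<Sum>b\<in>Basis. (arcsin (y \<bullet> b) / c) *\<^sub>R b)" for y :: 'a
  have S: "S x \<in> cbox (- One) One" for x
    by (auto simp: S_def mem_box)
  have "continuous_on (cbox (- One) One) A"
    unfolding A_def using c by (intro continuous_intros) (auto simp: mem_box)
  then have "continuous_on (cbox (- One) One) (\<lambda>y. f (A y))"
    using continuous_on_compose2[OF f] by blast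
  from Stone_Weierstrass_real_polynomial_function[OF compact_cbox this d]
  obtain p where p: "real_polynomial_function p"
    and close: "\<And>y. y \<in> cbox (- One) One \<Longrightarrow> \<bar>f (A y) - p y\<bar> < d"
    by blast
  show thesis
  proof
    show "trig_polynomial (\<lambda>x. complex_of_real (p (S x)))"
      unfolding S_def using p by (rule trig_polynomial_of_polynomial_sin)
    show "\<bar>f x - p (S x)\<bar> \<le> d" if "norm x \<le> R" for x
    proof -
      have "arcsin (S x \<bullet> b) / c = x \<bullet> b" if b: "b \<in> Basis" for b
      proof -
        have "\<bar>x \<bullet> b\<bar> \<le> R" using Basis_le_norm[OF b, of x] \<open>norm x \<le> R\<close> by linarith
        then have "\<bar>c * (x \<bullet> b)\<bar> \<le> pi / 2"
          using R mult_left_mono[of "\<bar>x \<bullet> b\<bar>" R c] c by (simp add: c_def abs_mult)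
        then have "arcsin (sin (c * (x \<bullet> b))) = c * (x \<bullet> b)"
          by (intro arcsin_sin) (auto simp: abs_le_iff)
        moreover have "S x \<bullet> b = sin (c * (x \<bullet> b))"
          using inner_sum_left_Basis[OF b] by (simp add: S_def inner_commute[of b x])
        ultimately show ?thesis using c by simp
      qed
      then have "A (S x) = x"
        unfolding A_def using euclidean_representation[of x] by simp
      then show ?thesis using close[OF S[of x]] by simp
    qed
    \<comment> \<open>\<open>S x\<close> lies in the cube for every \<open>x\<close>, so
      \<open>p (S x)\<close> is within \<open>d\<close> of a value of \<open>f\<close>, namely at
      \<open>A (S x)\<close>; two values of \<open>f\<close> differ by at most
      \<open>2 * B\<close>.\<close>
    show "\<bar>f x - p (S x)\<bar> \<le> d + 2 * B" for x
      using close[OF S[of x]] B[of x] B[of "A (S x)"] by linarith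
  qed
qed

text \<open>The excess of the integrand over \<open>d\<close> is at most \<open>B\<close> and is
  confined to the tail event.\<close>

lemma (in prob_space) expectation_diff_le:
  fixes f q :: "'b::euclidean_space \<Rightarrow> real"
  assumes [measurable]: "Z \<in> borel_measurable M"
    and int: "integrable M (\<lambda>x. f (Z x))" "integrable M (\<lambda>x. q (Z x))"
    and close: "\<And>x. norm x \<le> R \<Longrightarrow> \<bar>f x - q x\<bar> \<le> d" and far: "\<And>x. \<bar>f x - q x\<bar> \<le> d + B"
    and B: "B \<ge> 0" and tail: "prob {x \<in> space M. norm (Z x) > R} \<le> e"
  shows "\<bar>expectation (\<lambda>x. f (Z x)) - expectation (\<lambda>x. q (Z x))\<bar> \<le> d + B * e"
proof -
  define A where "A = {x \<in> space M. norm (Z x) > R}"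
  have [measurable]: "A \<in> sets M" unfolding A_def by measurable
  have "\<bar>expectation (\<lambda>x. f (Z x)) - expectation (\<lambda>x. q (Z x))\<bar> = \<bar>expectation (\<lambda>x. f (Z x) - q (Z x))\<bar>"
    using int by simp
  also have "\<dots> \<le> expectation (\<lambda>x. \<bar>f (Z x) - q (Z x)\<bar>)"
    by (rule integral_abs_bound)
  also have "\<dots> \<le> expectation (\<lambda>x. d + B * indicator A x)"
  proof (rule integral_mono)
    fix x assume "x \<in> space M"
    then show "\<bar>f (Z x) - q (Z x)\<bar> \<le> d + B * indicator A x"
      using close[of "Z x"] far[of "Z x"] by (cases "x \<in> A") (auto simp: A_def)
  qed (use int in \<open>auto intro!: integrable_abs integrable_add integrable_mult_right
      integrable_real_indicator simp: emeasure_eq_measure\<close>)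
  also have "\<dots> = d + B * prob A"
    by (subst Bochner_Integration.integral_add)
      (auto simp: prob_space emeasure_eq_measure intro!: integrable_mult_right integrable_real_indicator)
  also have "\<dots> \<le> d + B * e"
    using tail B by (simp add: A_def mult_left_mono)
  finally show ?thesis .
qed

text \<open>Tightness of a single law, meant for the limit: at each point the tail indicator
  vanishes once \<open>R\<close> exceeds the norm, and dominated convergence applies.\<close>

lemma (in prob_space) exists_norm_tail_le:
  fixes Z :: "'a \<Rightarrow> 'b::euclidean_space"
  assumes [measurable]: "Z \<in> borel_measurable M" and "e > 0"
  shows "\<exists>R0. \<forall>R\<ge>R0. prob {x \<in> space M. norm (Z x) > R} \<le> e"
proof -
  have "((\<lambda>R::real. expectation (\<lambda>x. indicator {x \<in> space M. norm (Z x) > R} x :: real)) \<longlongrightarrow> expectation (\<lambda>_. 0)) at_top"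
  proof (rule integral_dominated_convergence_at_top[where w = "\<lambda>_. 1"])
    show "AE x in M. ((\<lambda>R. indicator {x \<in> space M. norm (Z x) > R} x) \<longlongrightarrow> (0::real)) at_top"
    proof (rule AE_I2)
      fix x
      show "((\<lambda>R. indicator {x \<in> space M. norm (Z x) > R} x) \<longlongrightarrow> (0::real)) at_top"
        by (rule tendsto_eventually, rule eventually_mono[OF eventually_ge_at_top[of "norm (Z x)"]])
          (auto simp: indicator_def)
    qed
  qed (auto simp: indicator_def)
  then have "((\<lambda>R. prob {x \<in> space M. norm (Z x) > R}) \<longlongrightarrow> 0) at_top"
    by (simp add: Int_absorb2 Collect_restrict cong: conj_cong)
  from order_tendstoD(2)[OF this \<open>e > 0\<close>]
  show ?thesis by (auto simp: eventually_at_top_linorder intro: less_imp_le)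
qed

text \<open>Tightness is a premise because Hoeffding's inequality supplies it directly for the walk.
  The filter is arbitrary, so that real time is treated without passing to sequences.\<close>

lemma converges_in_law_if_char_tendsto:
  fixes Y :: "'t \<Rightarrow> 'a \<Rightarrow> 'b::euclidean_space"
  assumes M: "prob_space M" and N: "prob_space N" "sets N = sets borel"
    and meas: "\<forall>\<^sub>F t in F. Y t \<in> borel_measurable M"
    and char: "\<And>u. ((\<lambda>t. CLINT x|M. iexp (u \<bullet> Y t x)) \<longlongrightarrow> (CLINT x|N. iexp (u \<bullet> x))) F"
    and tight: "\<And>e. e > 0 \<Longrightarrow> \<exists>R. \<forall>\<^sub>F t in F. measure M {x \<in> space M. norm (Y t x) > R} \<le> e"
  shows "converges_in_law M Y F N"
  unfolding converges_in_law_def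
proof (intro conjI meas allI impI)
  fix f :: "'b \<Rightarrow> real" assume "continuous_on UNIV f \<and> bounded (range f)"
  then obtain B where f: "continuous_on UNIV f" and B: "\<And>x. \<bar>f x\<bar> \<le> B"
    by (auto simp: bounded_iff)
  have [measurable]: "f \<in> borel_measurable borel"
    using f by (rule borel_measurable_continuous_onI)
  have B0: "B \<ge> 0" using B[of 0] by linarith
  interpret M: prob_space M by fact
  interpret N: prob_space N by fact
  have idN: "(\<lambda>x. x) \<in> borel_measurable N" by (simp add: N(2) cong: measurable_cong_sets)
  show "((\<lambda>t. LINT x|M. f (Y t x)) \<longlongrightarrow> (LINT x|N. f x)) F"
  proof (rule tendstoI)
    fix e :: real assume e: "e > 0"
    \<comment> \<open>Two approximation errors \<open>d + 2 * B * d\<close> and one convergence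
      error \<open>d\<close> add up to at most \<open>3 * d * (1 + 2 * B)\<close>, which is three
      quarters of \<open>e\<close>.\<close>
    define d where "d = e / 4 / (1 + 2 * B)"
    have d: "d > 0" using e B0 by (simp add: d_def)
    obtain R1 where R1: "\<forall>\<^sub>F t in F. M.prob {x \<in> space M. norm (Y t x) > R1} \<le> d"
      using tight[OF d] by blast
    obtain R2 where R2: "\<And>R. R \<ge> R2 \<Longrightarrow> N.prob {x \<in> space N. norm x > R} \<le> d"
      using N.exists_norm_tail_le[OF idN d] by blast
    define R where "R = max (max R1 R2) 1"
    have R: "R > 0" by (simp add: R_def)
    obtain q where q: "trig_polynomial (\<lambda>x. complex_of_real (q x))"
      and close: "\<And>x. norm x \<le> R \<Longrightarrow> \<bar>f x - q x\<bar> \<le> d" "\<And>x. \<bar>f x - q x\<bar> \<le> d + 2 * B"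
      using trig_polynomial_approximation[OF f B R d] by blast
    \<comment> \<open>Stated for an arbitrary sample space, because it is applied to
      \<open>Y t\<close> under \<open>M\<close> and to the identity under \<open>N\<close>.\<close>
    have est: "\<bar>(LINT x|P. f (Z x)) - (LINT x|P. q (Z x))\<bar> \<le> d + 2 * B * d"
      if P: "prob_space P" and Z[measurable]: "Z \<in> borel_measurable P"
        and tail: "measure P {x \<in> space P. norm (Z x) > R} \<le> d" for P :: "'c measure" and Z
    proof -
      interpret P: prob_space P by fact
      have "integrable P (\<lambda>x. f (Z x))"
        by (rule P.integrable_const_bound[where B = B]) (auto simp: B)
      moreover have "integrable P (\<lambda>x. q (Z x))"
        using P.integrable_trig_polynomial[OF q Z] by (simp add: complex_of_real_integrable_eq)
      ultimately show ?thesis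
        using P.expectation_diff_le[OF Z _ _ close _ tail] B0 by simp
    qed
    have "((\<lambda>t. CLINT x|M. complex_of_real (q (Y t x))) \<longlongrightarrow> (CLINT x|N. complex_of_real (q x))) F"
      by (rule trig_polynomial_expectation_tendsto[OF q M N meas char])
    then have "((\<lambda>t. LINT x|M. q (Y t x)) \<longlongrightarrow> (LINT x|N. q x)) F"
      by (simp add: tendsto_of_real_iff)
    from tendstoD[OF this d] R1 meas
    show "\<forall>\<^sub>F t in F. dist (LINT x|M. f (Y t x)) (LINT x|N. f x) < e"
    proof eventually_elim
      case (elim t)
      have [measurable]: "Y t \<in> borel_measurable M" by fact
      have "M.prob {x \<in> space M. norm (Y t x) > R} \<le> M.prob {x \<in> space M. norm (Y t x) > R1}"
        by (intro M.finite_measure_mono) (auto simp: R_def)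
      then have 1: "\<bar>(LINT x|M. f (Y t x)) - (LINT x|M. q (Y t x))\<bar> \<le> d + 2 * B * d"
        using elim by (intro est M) auto
      have 2: "\<bar>(LINT x|N. f x) - (LINT x|N. q x)\<bar> \<le> d + 2 * B * d"
        using R2[of R] by (intro est N(1) idN) (auto simp: R_def)
      have "1 + 2 * B \<noteq> 0" using B0 by linarith
      then have "d * (1 + 2 * B) = e / 4" by (simp add: d_def del: divide_divide_eq_left)
      then have "3 * (d * (1 + 2 * B)) < e" using e by simp
      moreover have "2 * B * d \<ge> 0" using B0 d by simp
      ultimately show ?case
        using 1 2 elim(1) by (simp add: dist_real_def algebra_simps)
    qed
  qed
qed

text \<open>Slutsky's argument. The characteristic functions of \<open>Z t + E t\<close> and
  \<open>Z t\<close> differ by the expectation of a unimodular factor times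
  \<open>iexp (u \<bullet> E t x) - 1\<close>; this tends to 0 almost surely and is bounded by
  2.\<close>

lemma (in prob_space) converges_in_law_perturb:
  fixes Z E :: "real \<Rightarrow> 'a \<Rightarrow> 'b::euclidean_space"
  assumes N: "prob_space N" "sets N = sets borel"
    and [measurable]: "\<And>t. Z t \<in> borel_measurable M" "\<And>t. E t \<in> borel_measurable M"
    and char: "\<And>u. ((\<lambda>t. CLINT x|M. iexp (u \<bullet> Z t x)) \<longlongrightarrow> (CLINT x|N. iexp (u \<bullet> x))) at_top"
    and tight: "\<And>e. e > 0 \<Longrightarrow> \<exists>R. \<forall>\<^sub>F t in at_top. prob {x \<in> space M. norm (Z t x) > R} \<le> e"
    and E: "AE x in M. ((\<lambda>t. E t x) \<longlongrightarrow> 0) at_top"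
  shows "converges_in_law M (\<lambda>t x. Z t x + E t x) at_top N"
proof (rule converges_in_law_if_char_tendsto[OF prob_space_axioms N])
  show "\<forall>\<^sub>F t in at_top. (\<lambda>x. Z t x + E t x) \<in> borel_measurable M" by simp
  fix u
  have "((\<lambda>t. CLINT x|M. iexp (u \<bullet> Z t x) * (iexp (u \<bullet> E t x) - 1)) \<longlongrightarrow> (CLINT x|M. 0)) at_top"
  proof (rule integral_dominated_convergence_at_top[where w = "\<lambda>_. 2"])
    show "AE x in M. ((\<lambda>t. iexp (u \<bullet> Z t x) * (iexp (u \<bullet> E t x) - 1)) \<longlongrightarrow> 0) at_top"
      using E
    proof eventually_elim
      case (elim x)
      have "((\<lambda>t. iexp (u \<bullet> E t x) - 1) \<longlongrightarrow> iexp (u \<bullet> 0) - 1) at_top"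
        by (intro tendsto_intros elim)
      then have "((\<lambda>t. norm (iexp (u \<bullet> E t x) - 1)) \<longlongrightarrow> 0) at_top"
        by (simp add: tendsto_norm_zero_iff)
      then show ?case
        by (rule tendsto_norm_zero_cancel[OF tendsto_cong[THEN iffD1, rotated]])
          (auto simp: norm_mult simp del: of_real_mult)
    qed
    show "\<forall>\<^sub>F t in at_top. AE x in M. norm (iexp (u \<bullet> Z t x) * (iexp (u \<bullet> E t x) - 1)) \<le> 2"
    proof (intro always_eventually allI AE_I2)
      fix t x
      have "norm (iexp (u \<bullet> E t x) - 1) \<le> norm (iexp (u \<bullet> E t x)) + norm (1::complex)"
        by (rule norm_triangle_ineq4)
      then show "norm (iexp (u \<bullet> Z t x) * (iexp (u \<bullet> E t x) - 1)) \<le> 2"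
        by (simp add: norm_mult del: of_real_mult)
    qed
  qed auto
  from tendsto_add[OF char[of u] this]
  have "((\<lambda>t. (CLINT x|M. iexp (u \<bullet> Z t x)) + (CLINT x|M. iexp (u \<bullet> Z t x) * (iexp (u \<bullet> E t x) - 1)))
      \<longlongrightarrow> (CLINT x|N. iexp (u \<bullet> x))) at_top"
    by simp
  also have "(\<lambda>t. (CLINT x|M. iexp (u \<bullet> Z t x)) + (CLINT x|M. iexp (u \<bullet> Z t x) * (iexp (u \<bullet> E t x) - 1))) =
      (\<lambda>t. CLINT x|M. iexp (u \<bullet> (Z t x + E t x)))"
  proof
    fix t
    have *: "integrable M (\<lambda>x. iexp (u \<bullet> Z t x))"
      by (rule integrable_const_bound[where B = 1]) (auto simp del: of_real_mult)
    have **: "integrable M (\<lambda>x. iexp (u \<bullet> (Z t x + E t x)))"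
      by (rule integrable_const_bound[where B = 1]) (auto simp del: of_real_mult)
    have "iexp (u \<bullet> Z t x) * (iexp (u \<bullet> E t x) - 1) = iexp (u \<bullet> (Z t x + E t x)) - iexp (u \<bullet> Z t x)" for x
      by (simp add: inner_add_right distrib_left exp_add algebra_simps)
    then show "(CLINT x|M. iexp (u \<bullet> Z t x)) + (CLINT x|M. iexp (u \<bullet> Z t x) * (iexp (u \<bullet> E t x) - 1)) =
        (CLINT x|M. iexp (u \<bullet> (Z t x + E t x)))"
      using * ** by simp
  qed
  finally show "((\<lambda>t. CLINT x|M. iexp (u \<bullet> (Z t x + E t x))) \<longlongrightarrow> (CLINT x|N. iexp (u \<bullet> x))) at_top" .
next
  fix e :: real assume e: "e > 0"
  then obtain R where R: "\<forall>\<^sub>F t in at_top. prob {x \<in> space M. norm (Z t x) > R} \<le> e / 2"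
    using tight[of "e / 2"] by auto
  \<comment> \<open>If the sum exceeds \<open>R + 1\<close> in norm, then \<open>Z t\<close> exceeds
    \<open>R\<close> or \<open>E t\<close> exceeds 1; the second event has vanishing
    probability.\<close>
  define A where "A t = {x \<in> space M. norm (E t x) > 1}" for t
  have [measurable]: "A t \<in> sets M" for t unfolding A_def by measurable
  have "((\<lambda>t. expectation (\<lambda>x. indicator (A t) x :: real)) \<longlongrightarrow> expectation (\<lambda>_. 0)) at_top"
  proof (rule integral_dominated_convergence_at_top[where w = "\<lambda>_. 1"])
    show "AE x in M. ((\<lambda>t. indicator (A t) x) \<longlongrightarrow> (0::real)) at_top"
      using E
    proof eventually_elim
      case (elim x)
      from tendstoD[OF this, of 1] have "\<forall>\<^sub>F t in at_top. indicator (A t) x = (0::real)"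
        by (rule eventually_mono) (auto simp: A_def)
      then show ?case by (rule tendsto_eventually)
    qed
  qed (auto simp: indicator_def)
  then have "((\<lambda>t. prob (A t)) \<longlongrightarrow> 0) at_top" by simp
  then have "\<forall>\<^sub>F t in at_top. prob (A t) < e / 2" by (rule order_tendstoD) (use e in simp)
  with R have "\<forall>\<^sub>F t in at_top. prob {x \<in> space M. norm (Z t x + E t x) > R + 1} \<le> e"
  proof eventually_elim
    case (elim t)
    have "prob {x \<in> space M. norm (Z t x + E t x) > R + 1} \<le> prob ({x \<in> space M. norm (Z t x) > R} \<union> A t)"
    proof (intro finite_measure_mono subsetI)
      fix x assume "x \<in> {x \<in> space M. norm (Z t x + E t x) > R + 1}"
      then show "x \<in> {x \<in> space M. norm (Z t x) > R} \<union> A t"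
        using norm_triangle_ineq[of "Z t x" "E t x"] by (auto simp: A_def)
    qed measurable
    also have "\<dots> \<le> prob {x \<in> space M. norm (Z t x) > R} + prob (A t)"
      by (intro measure_Un_le) auto
    finally show ?case using elim by linarith
  qed
  then show "\<exists>R. \<forall>\<^sub>F t in at_top. prob {x \<in> space M. norm (Z t x + E t x) > R} \<le> e" by blast
qed

section \<open>Gaussian limits\<close>

lemma std_normal_distribution_scale:
  assumes "c \<noteq> 0"
  shows "distr std_normal_distribution borel (\<lambda>x. c * x) = density lborel (normal_density 0 \<bar>c\<bar>)"
proof -
  interpret real_distribution std_normal_distribution by (rule real_dist_normal_dist)
  have "distributed std_normal_distribution lborel (\<lambda>x. x) std_normal_density"
    by (simp add: distributed_def distr_id2)
  from normal_density_affine[OF this, of c 0] assms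
  have "distr std_normal_distribution lborel (\<lambda>x. c * x) = density lborel (normal_density 0 \<bar>c\<bar>)"
    by (simp add: distributed_def)
  then show ?thesis by (simp cong: distr_cong)
qed

text \<open>The joint law of the coordinates is the product measure itself, and its marginals are
  the factors; independence is this equality.\<close>

lemma indep_vars_PiM_coordinates:
  assumes "\<And>i. i \<in> I \<Longrightarrow> prob_space (P i)" and "I \<noteq> {}"
  shows "prob_space.indep_vars (Pi\<^sub>M I P) P (\<lambda>i \<omega>. \<omega> i) I"
proof -
  interpret prob_space "Pi\<^sub>M I P" by (intro prob_space_PiM assms)
  have "distr (Pi\<^sub>M I P) (Pi\<^sub>M I P) (\<lambda>\<omega>. \<lambda>i\<in>I. \<omega> i) = distr (Pi\<^sub>M I P) (Pi\<^sub>M I P) (\<lambda>\<omega>. \<omega>)"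
    by (intro distr_cong) (auto simp: space_PiM)
  also have "\<dots> = Pi\<^sub>M I (\<lambda>i. distr (Pi\<^sub>M I P) (P i) (\<lambda>\<omega>. \<omega> i))"
    by (auto simp: distr_PiM_component assms intro!: PiM_cong)
  finally show ?thesis
    by (subst indep_vars_iff_distr_eq_PiM') (auto simp: assms)
qed

text \<open>Such an \<open>N\<close> is the law of the sum of the vectors \<open>v i\<close>
  weighted by independent standard normals. A family of vectors, rather than a matrix, parametrizes
  the law because the covariance to be realized already is a sum of rank-one forms.\<close>

lemma centered_gaussian_exists:
  fixes v :: "'i \<Rightarrow> 'b::euclidean_space"
  assumes I: "finite I"
  obtains N where "prob_space N" "sets N = sets borel"
    and "\<And>u. distr N borel (\<lambda>x. u \<bullet> x) =
      (if (\<Sum>i\<in>I. (u \<bullet> v i)\<^sup>2) = 0 then return borel 0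
       else density lborel (normal_density 0 (sqrt (\<Sum>i\<in>I. (u \<bullet> v i)\<^sup>2))))"
proof -
  define P where "P = Pi\<^sub>M I (\<lambda>_. std_normal_distribution)"
  have std: "prob_space std_normal_distribution"
    using real_dist_normal_dist by (simp add: real_distribution_def)
  interpret P: prob_space P unfolding P_def by (intro prob_space_PiM std)
  have coord[measurable]: "(\<lambda>\<omega>. \<omega> i) \<in> borel_measurable P" if "i \<in> I" for i
    using measurable_component_singleton[OF that, of "\<lambda>_. std_normal_distribution"]
    by (simp add: P_def cong: measurable_cong_sets)
  define Z where "Z \<omega> = (\<Sum>i\<in>I. \<omega> i *\<^sub>R v i)" for \<omega>
  have Z[measurable]: "Z \<in> borel_measurable P"
    unfolding Z_def by (intro borel_measurable_sum borel_measurable_scaleR) auto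
  define N where "N = distr P borel Z"
  show thesis
  proof
    show "prob_space N" unfolding N_def by (rule P.prob_space_distr) simp
    show "sets N = sets borel" by (simp add: N_def)
    fix u
    define s where "s = (\<Sum>i\<in>I. (u \<bullet> v i)\<^sup>2)"
    \<comment> \<open>Normal densities require a positive standard deviation, so directions
      orthogonal to \<open>u\<close> are discarded; if none is left the law is the Dirac
      mass.\<close>
    define J where "J = {i \<in> I. u \<bullet> v i \<noteq> 0}"
    have J: "finite J" "J \<subseteq> I" using I by (auto simp: J_def)
    have sJ: "s = (\<Sum>i\<in>J. (u \<bullet> v i)\<^sup>2)"
      unfolding s_def by (rule sum.mono_neutral_right) (use I in \<open>auto simp: J_def\<close>)
    have uZ: "u \<bullet> Z \<omega> = (\<Sum>i\<in>J. (u \<bullet> v i) * \<omega> i)" for \<omega>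
      unfolding Z_def inner_sum_right
      by (subst sum.mono_neutral_right[of I J]) (use I in \<open>auto simp: J_def mult.commute\<close>)
    have N: "distr N borel (\<lambda>x. u \<bullet> x) = distr P borel (\<lambda>\<omega>. \<Sum>i\<in>J. (u \<bullet> v i) * \<omega> i)"
      unfolding N_def by (subst distr_distr) (auto simp: comp_def uZ)
    show "distr N borel (\<lambda>x. u \<bullet> x) =
      (if s = 0 then return borel 0 else density lborel (normal_density 0 (sqrt s)))"
    proof (cases "J = {}")
      case True
      then show ?thesis unfolding N by (simp add: sJ P.distr_const)
    next
      case False
      then have s: "s > 0" unfolding sJ using J by (intro sum_pos) (auto simp: J_def)
      have "P.indep_vars (\<lambda>_. std_normal_distribution) (\<lambda>i \<omega>. \<omega> i) I"
        unfolding P_def using False J by (intro indep_vars_PiM_coordinates std) auto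
      then have "P.indep_vars (\<lambda>_. std_normal_distribution) (\<lambda>i \<omega>. \<omega> i) J"
        using J(2) by (rule P.indep_vars_subset)
      then have ind: "P.indep_vars (\<lambda>_. borel) (\<lambda>i \<omega>. (u \<bullet> v i) * \<omega> i) J"
        by (rule P.indep_vars_compose2) simp
      have "distributed P lborel (\<lambda>\<omega>. \<Sum>i\<in>J. (u \<bullet> v i) * \<omega> i)
          (normal_density (\<Sum>i\<in>J. 0) (sqrt (\<Sum>i\<in>J. \<bar>u \<bullet> v i\<bar>\<^sup>2)))"
      proof (rule P.sum_indep_normal[OF J(1) False ind])
        fix i assume i: "i \<in> J"
        then have iI: "i \<in> I" and nz: "u \<bullet> v i \<noteq> 0" by (auto simp: J_def)
        show "0 < \<bar>u \<bullet> v i\<bar>" using nz by simp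
        have "distr P std_normal_distribution (\<lambda>\<omega>. \<omega> i) = std_normal_distribution"
          unfolding P_def using std iI by (intro distr_PiM_component) auto
        then have "distr std_normal_distribution borel (\<lambda>x. (u \<bullet> v i) * x) =
            distr (distr P std_normal_distribution (\<lambda>\<omega>. \<omega> i)) borel (\<lambda>x. (u \<bullet> v i) * x)"
          by simp
        also have "\<dots> = distr P borel (\<lambda>\<omega>. (u \<bullet> v i) * \<omega> i)"
          using coord[OF iI] by (subst distr_distr) (auto simp: comp_def cong: measurable_cong_sets)
        finally have "distr P borel (\<lambda>\<omega>. (u \<bullet> v i) * \<omega> i) = density lborel (normal_density 0 \<bar>u \<bullet> v i\<bar>)"
          using std_normal_distribution_scale[OF nz] by simp
        then show "distributed P lborel (\<lambda>\<omega>. (u \<bullet> v i) * \<omega> i) (normal_density 0 \<bar>u \<bullet> v i\<bar>)"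
          using coord[OF iI] by (auto simp: distributed_def cong: distr_cong)
      qed
      then have "distr P borel (\<lambda>\<omega>. \<Sum>i\<in>J. (u \<bullet> v i) * \<omega> i) = density lborel (normal_density 0 (sqrt s))"
        by (simp add: distributed_def sJ cong: distr_cong)
      then show ?thesis unfolding N using s by simp
    qed
  qed
qed

text \<open>The Cramer-Wold reduction: for fixed \<open>u\<close> only the scalar variables
  \<open>u \<bullet> Y i\<close> matter, and the one-dimensional central limit theorem applies to
  them.\<close>

lemma (in prob_space) char_normalized_sum_tendsto:
  fixes Y :: "nat \<Rightarrow> 'a \<Rightarrow> 'b::euclidean_space"
  assumes indep: "indep_vars (\<lambda>_. borel) Y UNIV"
    and bound: "\<And>i. AE x in M. norm (Y i x) \<le> C"
    and mean: "\<And>i. expectation (Y i) = 0"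
    and distr: "\<And>i. distr M borel (Y i) = \<mu>"
    and N: "sets N = sets borel"
    and normal: "distr N borel (\<lambda>x. u \<bullet> x) =
      (if expectation (\<lambda>x. (u \<bullet> Y 0 x)\<^sup>2) = 0 then return borel 0
       else density lborel (normal_density 0 (sqrt (expectation (\<lambda>x. (u \<bullet> Y 0 x)\<^sup>2)))))"
  shows "(\<lambda>n. CLINT x|M. iexp (u \<bullet> ((\<Sum>i<n. Y i x) /\<^sub>R sqrt n))) \<longlonglongrightarrow> (CLINT x|N. iexp (u \<bullet> x))"
proof -
  have [measurable]: "Y i \<in> borel_measurable M" for i
    using indep by (auto simp: indep_vars_def)
  define W where "W i x = u \<bullet> Y i x" for i x
  have W[measurable]: "W i \<in> borel_measurable M" for i unfolding W_def by measurable
  define s where "s = expectation (\<lambda>x. (W 0 x)\<^sup>2)"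
  have int: "integrable M (Y i)" for i
    by (rule integrable_const_bound[OF bound]) simp
  have W_mean: "expectation (W i) = 0" for i
    unfolding W_def using int mean by simp
  have W_bound: "AE x in M. norm ((W i x)\<^sup>2) \<le> (norm u * C)\<^sup>2" for i
    using bound[of i]
  proof eventually_elim
    case (elim x)
    have "\<bar>W i x\<bar> \<le> norm u * norm (Y i x)" unfolding W_def by (rule Cauchy_Schwarz_ineq2)
    also have "\<dots> \<le> norm u * C" using elim by (rule mult_left_mono) simp
    finally show ?case using power_mono[of "\<bar>W i x\<bar>" "norm u * C" 2] by simp
  qed
  have W_int: "integrable M (\<lambda>x. (W i x)\<^sup>2)" for i
    by (rule integrable_const_bound[OF W_bound]) simp
  have W_distr: "distr M borel (W i) = distr \<mu> borel (\<lambda>y. u \<bullet> y)" for i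
    unfolding W_def distr[of i, symmetric] by (subst distr_distr) (auto simp: comp_def)
  have W_var: "expectation (\<lambda>x. (W i x)\<^sup>2) = s" for i
  proof -
    have "expectation (\<lambda>x. (W i x)\<^sup>2) = (LINT y|distr M borel (W i). y\<^sup>2)" for i
      by (simp add: integral_distr)
    then show ?thesis unfolding s_def W_distr by simp
  qed
  have sum: "u \<bullet> ((\<Sum>i<n. Y i x) /\<^sub>R sqrt n) = (\<Sum>i<n. W i x) / sqrt n" for n x
    by (simp add: W_def inner_sum_right divide_inverse mult.commute)
  have lim: "(CLINT x|N. iexp (u \<bullet> x)) = (CLINT y|distr N borel (\<lambda>x. u \<bullet> x). iexp y)"
    by (subst integral_distr) (auto simp: N cong: measurable_cong_sets)
  show ?thesis
  proof (cases "s = 0")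
    \<comment> \<open>The central limit theorem requires positive variance. Here all
      \<open>W i\<close> vanish almost surely, and both sides are 1.\<close>
    case True
    have "AE x in M. (W i x)\<^sup>2 = 0" for i
      using integral_nonneg_eq_0_iff_AE[OF W_int[of i]] W_var[of i] True by simp
    then have "AE x in M. \<forall>i. (W i x)\<^sup>2 = 0"
      unfolding AE_all_countable by blast
    then have W0: "AE x in M. \<forall>i. W i x = 0" by eventually_elim simp
    have "(CLINT x|M. iexp (u \<bullet> ((\<Sum>i<n. Y i x) /\<^sub>R sqrt n))) = (CLINT x|M. 1)" for n
      unfolding sum
    proof (rule integral_cong_AE)
      show "AE x in M. iexp ((\<Sum>i<n. W i x) / sqrt n) = 1"
        using W0 by eventually_elim simp
    qed measurable
    moreover have "(CLINT x|N. iexp (u \<bullet> x)) = 1"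
      using normal True unfolding lim by (simp add: s_def W_def integral_return)
    ultimately show ?thesis by (simp add: prob_space)
  next
    case False
    have "s \<ge> 0" unfolding s_def by simp
    with False have s: "s > 0" by simp
    have W_indep: "indep_vars (\<lambda>_. borel) W UNIV"
      unfolding W_def using indep_vars_compose2[OF indep, of "\<lambda>_ y. u \<bullet> y" "\<lambda>_. borel"] by simp
    have "weak_conv_m (\<lambda>n. distr M borel (\<lambda>x. (\<Sum>i<n. W i x) / sqrt (real n * (sqrt s)\<^sup>2))) std_normal_distribution"
      using s by (intro central_limit_theorem_zero_mean[OF W_indep W_mean _ W_int _ W_distr])
        (auto simp: W_mean W_var)
    \<comment> \<open>The theorem normalizes the variance to 1; evaluating characteristic functions
      at \<open>sqrt s\<close> undoes that scaling.\<close>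
    then have "(\<lambda>n. char (distr M borel (\<lambda>x. (\<Sum>i<n. W i x) / sqrt (real n * (sqrt s)\<^sup>2))) (sqrt s))
        \<longlonglongrightarrow> char std_normal_distribution (sqrt s)"
      by (intro levy_continuity1 real_dist_normal_dist real_distribution_distr) auto
    moreover have "char (distr M borel (\<lambda>x. (\<Sum>i<n. W i x) / sqrt (real n * (sqrt s)\<^sup>2))) (sqrt s) =
        (CLINT x|M. iexp (u \<bullet> ((\<Sum>i<n. Y i x) /\<^sub>R sqrt n)))" for n
      unfolding char_def sum using s by (subst integral_distr) (auto simp: real_sqrt_mult)
    moreover have "char std_normal_distribution (sqrt s) = (CLINT x|N. iexp (u \<bullet> x))"
    proof -
      have "distr N borel (\<lambda>x. u \<bullet> x) = distr std_normal_distribution borel (\<lambda>x. sqrt s * x)"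
        using normal s std_normal_distribution_scale[of "sqrt s"] by (simp add: s_def W_def)
      then show ?thesis unfolding lim char_def by (simp add: integral_distr)
    qed
    ultimately show ?thesis by simp
  qed
qed

section \<open>Concatenations of independent random paths\<close>

text \<open>Retains of the crystal a finite set \<open>B\<close> of bounded paths with weights
  \<open>p\<close>; both limit theorems are proved at this level.\<close>

locale random_path = prob_space M for M :: "'w measure" +
  fixes B :: "(real \<Rightarrow> real^'n::finite) set" and p :: "(real \<Rightarrow> real^'n) \<Rightarrow> real"
    and X :: "nat \<Rightarrow> 'w \<Rightarrow> real \<Rightarrow> real^'n"
  assumes finite_paths: "finite B"
    and bounded_paths: "\<And>\<eta>. \<eta> \<in> B \<Longrightarrow> bounded (\<eta> ` {0..1})"
    and p_nonneg: "\<And>\<eta>. \<eta> \<in> B \<Longrightarrow> 0 \<le> p \<eta>"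
    and indep: "indep_vars (\<lambda>_. count_space B) X {1..}"
    and law: "\<And>l. l \<ge> 1 \<Longrightarrow> distributed M (count_space B) (X l) (\<lambda>\<eta>. ennreal (p \<eta>))"
begin

definition drift :: "real \<Rightarrow> real^'n" where
  "drift = (\<lambda>t\<in>{0..1}. \<Sum>\<eta>\<in>B. p \<eta> *\<^sub>R \<eta> t)"

text \<open>The shift by one makes \<open>walk n\<close> depend on exactly the \<open>n\<close>
  paths \<open>X 1\<close> to \<open>X n\<close> completed by time \<open>n\<close>.\<close>

definition incr :: "nat \<Rightarrow> 'w \<Rightarrow> real^'n" where
  "incr i \<omega> = X (Suc i) \<omega> 1 - drift 1"

definition walk :: "nat \<Rightarrow> 'w \<Rightarrow> real^'n" where
  "walk n \<omega> = (\<Sum>i<n. incr i \<omega>)"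

lemma X_measurable [measurable]: "l \<ge> 1 \<Longrightarrow> X l \<in> M \<rightarrow>\<^sub>M count_space B"
  using distributed_measurable[OF law] .

lemma X_in: "l \<ge> 1 \<Longrightarrow> \<omega> \<in> space M \<Longrightarrow> X l \<omega> \<in> B"
  using measurable_space[OF X_measurable] by simp

lemma distr_X: "l \<ge> 1 \<Longrightarrow> distr M (count_space B) (X l) = density (count_space B) p"
  using distributed_distr_eq_density[OF law] .

text \<open>No condition on \<open>g\<close> appears: on the finite counting space every function is
  measurable and integrable.\<close>

lemma expectation_X:
  fixes g :: "(real \<Rightarrow> real^'n) \<Rightarrow> 'b::{banach, second_countable_topology}"
  assumes "l \<ge> 1"
  shows "expectation (\<lambda>\<omega>. g (X l \<omega>)) = (\<Sum>\<eta>\<in>B. p \<eta> *\<^sub>R g \<eta>)"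
proof -
  have "expectation (\<lambda>\<omega>. g (X l \<omega>)) = integral\<^sup>L (distr M (count_space B) (X l)) g"
    using assms by (subst integral_distr) auto
  also have "\<dots> = (\<integral>\<eta>. p \<eta> *\<^sub>R g \<eta> \<partial>count_space B)"
    unfolding distr_X[OF assms] by (rule integral_density) (auto simp: AE_count_space p_nonneg)
  finally show ?thesis by (simp add: lebesgue_integral_count_space_finite finite_paths)
qed

lemma measurable_X:
  fixes g :: "(real \<Rightarrow> real^'n) \<Rightarrow> 'b::topological_space"
  assumes "l \<ge> 1"
  shows "(\<lambda>\<omega>. g (X l \<omega>)) \<in> borel_measurable M"
  using X_measurable[OF assms] by (rule measurable_compose) simp

lemma sum_p: "(\<Sum>\<eta>\<in>B. p \<eta>) = 1"
  using expectation_X[of 1 "\<lambda>_. 1 :: real"] by (simp add: prob_space)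

text \<open>The drift is a convex combination of the paths, so one constant bounds both.\<close>

lemma paths_bound:
  obtains K where "K > 0" "\<And>\<eta> t. \<eta> \<in> B \<Longrightarrow> t \<in> {0..1} \<Longrightarrow> norm (\<eta> t) \<le> K"
    "\<And>t. t \<in> {0..1} \<Longrightarrow> norm (drift t) \<le> K"
proof -
  have "bounded (\<Union>\<eta>\<in>B. \<eta> ` {0..1})"
    using finite_paths bounded_paths by (intro bounded_UN) auto
  then obtain K where K: "K > 0" "\<And>\<eta> t. \<eta> \<in> B \<Longrightarrow> t \<in> {0..1} \<Longrightarrow> norm (\<eta> t) \<le> K"
    unfolding bounded_pos by blast
  have "norm (drift t) \<le> K" if t: "t \<in> {0..1}" for t
  proof -
    have "norm (drift t) \<le> (\<Sum>\<eta>\<in>B. norm (p \<eta> *\<^sub>R \<eta> t))"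
      using t by (simp add: drift_def norm_sum del: norm_scaleR)
    also have "\<dots> \<le> (\<Sum>\<eta>\<in>B. p \<eta> * K)"
      using K(2) t p_nonneg by (intro sum_mono) (auto intro!: mult_left_mono)
    finally show ?thesis by (simp add: sum_p flip: sum_distrib_right)
  qed
  with K that show thesis by blast
qed

lemma incr_measurable [measurable]: "incr i \<in> borel_measurable M"
  using measurable_X[of "Suc i" "\<lambda>\<eta>. \<eta> 1 - drift 1"] by (simp add: incr_def[abs_def])

lemma walk_measurable [measurable]: "walk n \<in> borel_measurable M"
  unfolding walk_def by measurable

lemma incr_bounded: "\<exists>C>0. \<forall>i. \<forall>\<omega>\<in>space M. norm (incr i \<omega>) \<le> C"
proof -
  obtain K where K: "K > 0" "\<And>\<eta> t. \<eta> \<in> B \<Longrightarrow> t \<in> {0..1} \<Longrightarrow> norm (\<eta> t) \<le> K"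
    "\<And>t. t \<in> {0..1} \<Longrightarrow> norm (drift t) \<le> K"
    using paths_bound by blast
  have "norm (incr i \<omega>) \<le> K + K" if "\<omega> \<in> space M" for i \<omega>
    unfolding incr_def
    using K(2)[of "X (Suc i) \<omega>" 1] K(3)[of 1] X_in[OF _ that, of "Suc i"]
    by (intro order_trans[OF norm_triangle_ineq4] add_mono) auto
  then show ?thesis using K(1) by (intro exI[of _ "K + K"]) auto
qed

lemma expectation_incr:
  fixes g :: "real^'n \<Rightarrow> 'b::{banach, second_countable_topology}"
  shows "expectation (\<lambda>\<omega>. g (incr i \<omega>)) = (\<Sum>\<eta>\<in>B. p \<eta> *\<^sub>R g (\<eta> 1 - drift 1))"
  unfolding incr_def by (subst expectation_X) auto

lemma incr_mean: "expectation (incr i) = 0"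
proof -
  have "expectation (incr i) = (\<Sum>\<eta>\<in>B. p \<eta> *\<^sub>R (\<eta> 1 - drift 1))"
    using expectation_incr[of "\<lambda>x. x" i] by simp
  also have "\<dots> = (\<Sum>\<eta>\<in>B. p \<eta> *\<^sub>R \<eta> 1) - (\<Sum>\<eta>\<in>B. p \<eta>) *\<^sub>R drift 1"
    by (simp add: scaleR_diff_right sum_subtractf scaleR_sum_left)
  also have "\<dots> = 0" by (simp add: sum_p) (simp add: drift_def)
  finally show ?thesis .
qed

lemma incr_indep: "indep_vars (\<lambda>_. borel) incr UNIV"
proof -
  have "indep_vars (\<lambda>_. count_space B) (\<lambda>i. X (Suc i)) UNIV"
    using indep_vars_reindex[of "\<lambda>_. count_space B" X Suc UNIV] indep_vars_subset[OF indep, of "range Suc"]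
    by auto
  from indep_vars_compose2[OF this, of "\<lambda>_ \<eta>. \<eta> 1 - drift 1" "\<lambda>_. borel"]
  show ?thesis unfolding incr_def by simp
qed

lemma distr_incr: "distr M borel (incr i) = distr (density (count_space B) p) borel (\<lambda>\<eta>. \<eta> 1 - drift 1)"
proof -
  have "distr M borel (incr i) = distr (distr M (count_space B) (X (Suc i))) borel (\<lambda>\<eta>. \<eta> 1 - drift 1)"
    by (subst distr_distr) (auto simp: comp_def incr_def[abs_def])
  then show ?thesis by (simp add: distr_X)
qed

text \<open>Completed steps cancel exactly against the walk and the drift at integer times. What
  remains is the current path minus the drift on the fractional part of \<open>t\<close>.\<close>

lemma concat_paths_deviation:
  "\<exists>K. \<forall>t\<ge>0. \<forall>\<omega>\<in>space M.
     norm (concat_paths (\<lambda>l. X l \<omega>) t - periodic_drift drift t - walk (nat \<lfloor>t\<rfloor>) \<omega>) \<le> K"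
proof -
  obtain K where K: "K > 0" "\<And>\<eta> t. \<eta> \<in> B \<Longrightarrow> t \<in> {0..1} \<Longrightarrow> norm (\<eta> t) \<le> K"
    "\<And>t. t \<in> {0..1} \<Longrightarrow> norm (drift t) \<le> K"
    using paths_bound by blast
  have "norm (concat_paths (\<lambda>l. X l \<omega>) t - periodic_drift drift t - walk (nat \<lfloor>t\<rfloor>) \<omega>) \<le> K + K"
    if t: "0 \<le> t" and \<omega>: "\<omega> \<in> space M" for t \<omega>
  proof -
    define k where "k = nat \<lfloor>t\<rfloor>"
    have k: "of_int \<lfloor>t\<rfloor> = real k" using t by (simp add: k_def)
    have r: "t - real k \<in> {0..1}" unfolding k[symmetric] by (auto; linarith)
    have "concat_paths (\<lambda>l. X l \<omega>) t - periodic_drift drift t - walk (nat \<lfloor>t\<rfloor>) \<omega> =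
        X (Suc k) \<omega> (t - real k) - drift (t - real k)"
      unfolding concat_paths_def periodic_drift_def walk_def incr_def Let_def k k_def[symmetric]
      by (simp add: sum_subtractf sum.atLeast1_atMost_eq sum_constant_scaleR del: sum_constant)
    also have "norm \<dots> \<le> K + K"
      using K(2)[OF X_in[OF _ \<omega>] r] K(3)[OF r] by (intro order_trans[OF norm_triangle_ineq4] add_mono) auto
    finally show ?thesis .
  qed
  then show ?thesis by blast
qed

text \<open>Up to time \<open>t\<close> only finitely many of the paths are read. Their tuple takes
  values in a finite set, on which every function is measurable, so the infima in the transforms
  raise no measurability question.\<close>

lemma pitman_word_measurable [measurable]:
  "(\<lambda>\<omega>. pitman_word ip \<alpha> js (concat_paths (\<lambda>l. X l \<omega>)) t) \<in> borel_measurable M"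
proof -
  define k where "k = Suc (nat \<lfloor>t\<rfloor>)"
  let ?F = "\<lambda>x. pitman_word ip \<alpha> js (concat_paths x) t"
  have "?F (\<lambda>l. X l \<omega>) = ?F (\<lambda>l\<in>{1..k}. X l \<omega>)" for \<omega>
  proof (rule pitman_word_cong)
    fix s assume "s \<le> t"
    then have "nat \<lfloor>s\<rfloor> < k" unfolding k_def by (simp add: floor_mono nat_mono le_imp_less_Suc)
    then show "concat_paths (\<lambda>l. X l \<omega>) s = concat_paths (\<lambda>l\<in>{1..k}. X l \<omega>) s"
      unfolding concat_paths_def Let_def by (auto intro!: arg_cong2[where f = "(+)"] sum.cong)
  qed
  moreover have "(\<lambda>\<omega>. \<lambda>l\<in>{1..k}. X l \<omega>) \<in> M \<rightarrow>\<^sub>M count_space (PiE {1..k} (\<lambda>_. B))"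
    using measurable_restrict[of "{1..k}" X M "\<lambda>_. count_space B"] X_measurable finite_paths
    by (simp add: count_space_PiM_finite countable_finite)
  then have "(\<lambda>\<omega>. ?F (\<lambda>l\<in>{1..k}. X l \<omega>)) \<in> borel_measurable M"
    by (rule measurable_compose) simp
  ultimately show ?thesis by simp
qed

lemma walk_strong_law: "AE \<omega> in M. (\<lambda>n. walk n \<omega> /\<^sub>R n) \<longlonglongrightarrow> 0"
proof -
  obtain C where "C > 0" and C: "\<And>i \<omega>. \<omega> \<in> space M \<Longrightarrow> norm (incr i \<omega>) \<le> C"
    using incr_bounded by blast
  from bounded_strong_law[OF incr_indep _ this(1) incr_mean]
  show ?thesis unfolding walk_def using C by simp
qed

lemma pitman_word_deviation:
  assumes bil: "bilinear ip" and pos: "\<And>i. ip (drift 1) (coroot ip (\<alpha> i)) > 0"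
  shows "AE \<omega> in M. \<exists>K. \<forall>t\<ge>0.
     norm (pitman_word ip \<alpha> js (concat_paths (\<lambda>l. X l \<omega>)) t - periodic_drift drift t - walk (nat \<lfloor>t\<rfloor>) \<omega>) \<le> K"
  using walk_strong_law AE_space
proof eventually_elim
  case (elim \<omega>)
  let ?W = "concat_paths (\<lambda>l. X l \<omega>)"
  obtain K where K: "\<And>t. 0 \<le> t \<Longrightarrow> norm (?W t - periodic_drift drift t - walk (nat \<lfloor>t\<rfloor>) \<omega>) \<le> K"
    using concat_paths_deviation elim(2) by blast
  obtain L where L: "\<And>t. t \<in> {0..1} \<Longrightarrow> norm (drift t) \<le> L" by (rule paths_bound) blast
  obtain b where b: "b > 0" "\<And>x y. norm (ip x y) \<le> b * norm x * norm y"
    using bilinear_bounded_pos[OF bil] by blast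
  have "\<exists>C. \<forall>t\<ge>0. C \<le> ip (?W t) (coroot ip (\<alpha> i))" for i
  proof -
    define c where "c = coroot ip (\<alpha> i)"
    have norm_le: "\<bar>ip x c\<bar> \<le> b * norm c * norm x" for x
      using b(2)[of x c] by (simp add: mult_ac)
    have "(\<lambda>n. b * norm c * norm (walk n \<omega> /\<^sub>R n)) \<longlonglongrightarrow> 0"
      by (intro tendsto_mult_right_zero tendsto_norm_zero elim)
    then have "(\<lambda>n. (b * norm c * norm (walk n \<omega>)) / n) \<longlonglongrightarrow> 0"
      by (simp add: divide_inverse mult_ac)
    \<comment> \<open>The rate is the pairing of the drift itself: the linear gain of the drift then
      compensates the fluctuations of the walk up to the constant \<open>A\<close>.\<close>
    from sublinear_bound[OF this pos[of i]]
    obtain A where A: "\<And>n. b * norm c * norm (walk n \<omega>) \<le> ip (drift 1) c * n + A"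
      unfolding c_def by blast
    have "- A - b * norm c * (L + K) \<le> ip (?W t) c" if t: "0 \<le> t" for t
    proof -
      define k where "k = nat \<lfloor>t\<rfloor>"
      have k: "of_int \<lfloor>t\<rfloor> = real k" using t by (simp add: k_def)
      \<comment> \<open>The bounded part of the path: the drift over the fractional time and the
        error already controlled by \<open>K\<close>.\<close>
      define r where "r = drift (t - real k) + (?W t - periodic_drift drift t - walk k \<omega>)"
      have "t - real k \<in> {0..1}" unfolding k[symmetric] by (auto; linarith)
      then have "norm r \<le> L + K"
        unfolding r_def k_def using L K[OF t] by (intro norm_triangle_mono) auto
      then have "b * norm c * norm r \<le> b * norm c * (L + K)"
        using b(1) by (intro mult_left_mono) auto
      moreover have "?W t = real k *\<^sub>R drift 1 + walk k \<omega> + r"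
        unfolding r_def periodic_drift_def k by simp
      then have "ip (?W t) c = real k * ip (drift 1) c + ip (walk k \<omega>) c + ip r c"
        by (simp add: bilinear_ladd[OF bil] bilinear_lmul[OF bil])
      ultimately show ?thesis
        using norm_le[of r] norm_le[of "walk k \<omega>"] A[of k] by (simp add: mult.commute)
    qed
    then show ?thesis unfolding c_def by blast
  qed
  from pitman_word_dist_bounded[where \<alpha> = \<alpha> and js = js, OF bil this]
  obtain K' where K': "\<And>t. 0 \<le> t \<Longrightarrow> norm (pitman_word ip \<alpha> js ?W t - ?W t) \<le> K'" by blast
  have "norm (pitman_word ip \<alpha> js ?W t - periodic_drift drift t - walk (nat \<lfloor>t\<rfloor>) \<omega>) \<le> K' + K"
    if t: "0 \<le> t" for t
  proof -
    have "pitman_word ip \<alpha> js ?W t - periodic_drift drift t - walk (nat \<lfloor>t\<rfloor>) \<omega> =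
        (pitman_word ip \<alpha> js ?W t - ?W t) + (?W t - periodic_drift drift t - walk (nat \<lfloor>t\<rfloor>) \<omega>)"
      by simp
    also have "norm \<dots> \<le> K' + K" using K'[OF t] K[OF t] by (rule norm_triangle_mono)
    finally show ?thesis .
  qed
  then show ?case by blast
qed

section \<open>The two limits of the deviation from the drift path\<close>

definition deviation ::
  "(real^'n \<Rightarrow> real^'n \<Rightarrow> real) \<Rightarrow> ('n \<Rightarrow> real^'n) \<Rightarrow> 'n list \<Rightarrow> real \<Rightarrow> 'w \<Rightarrow> real^'n" where
  "deviation ip \<alpha> js t \<omega> =
     pitman_word ip \<alpha> js (concat_paths (\<lambda>l. X l \<omega>)) t - periodic_drift drift t"

lemma deviation_measurable [measurable]: "deviation ip \<alpha> js t \<in> borel_measurable M"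
  unfolding deviation_def by measurable

lemma deviation_sup_tendsto:
  assumes sp: "scalar_product ip" and pos: "\<And>i. ip (drift 1) (coroot ip (\<alpha> i)) > 0"
  shows "AE \<omega> in M. (\<lambda>l::nat. (1 / real l) *
    (SUP t\<in>{0..real l}. sqrt (ip (deviation ip \<alpha> js t \<omega>) (deviation ip \<alpha> js t \<omega>)))) \<longlonglongrightarrow> 0"
proof -
  have bil: "bilinear ip" and pd: "\<And>x. x \<noteq> 0 \<Longrightarrow> ip x x > 0"
    using sp by (auto simp: scalar_product_def)
  have nonneg: "ip x x \<ge> 0" for x
    using pd[of x] by (cases "x = 0") (auto simp: bilinear_lzero[OF bil])
  obtain b where b: "b > 0" "\<And>x y. norm (ip x y) \<le> b * norm x * norm y"
    using bilinear_bounded_pos[OF bil] by blast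
  have norm_le: "sqrt (ip x x) \<le> sqrt b * norm x" for x
  proof -
    have "ip x x \<le> b * (norm x)\<^sup>2" using b(2)[of x x] by (simp add: power2_eq_square)
    then have "sqrt (ip x x) \<le> sqrt (b * (norm x)\<^sup>2)" by (rule real_sqrt_le_mono)
    then show ?thesis by (simp add: real_sqrt_mult)
  qed
  show ?thesis
    using pitman_word_deviation[where ip = ip and \<alpha> = \<alpha> and js = js, OF bil pos] walk_strong_law
  proof eventually_elim
    case (elim \<omega>)
    let ?f = "\<lambda>t. sqrt (ip (deviation ip \<alpha> js t \<omega>) (deviation ip \<alpha> js t \<omega>))"
    obtain K where K: "\<And>t. 0 \<le> t \<Longrightarrow> norm (deviation ip \<alpha> js t \<omega> - walk (nat \<lfloor>t\<rfloor>) \<omega>) \<le> K"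
      using elim(1) unfolding deviation_def by blast
    show ?case
    proof (rule tendstoI)
      fix e :: real assume e: "e > 0"
      \<comment> \<open>Comparing the invariant norm with the Euclidean one costs a factor
        \<open>sqrt b\<close>; this \<open>d\<close> makes the resulting slope
        \<open>e / 2\<close>.\<close>
      define d where "d = e / (2 * sqrt b)"
      have d: "d > 0" "sqrt b * d = e / 2" using e b by (simp_all add: d_def)
      have "(\<lambda>n. norm (walk n \<omega>) / n) \<longlonglongrightarrow> 0"
        using tendsto_norm_zero[OF elim(2)] by (simp add: divide_inverse mult.commute)
      from sublinear_bound[OF this d(1)]
      obtain A where A: "\<And>n. norm (walk n \<omega>) \<le> d * n + A" by blast
      have f_le: "?f t \<le> sqrt b * (K + A) + e / 2 * l" if t: "t \<in> {0..real l}" for t l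
      proof -
        have "real (nat \<lfloor>t\<rfloor>) \<le> l" using t by auto linarith
        then have "d * real (nat \<lfloor>t\<rfloor>) \<le> d * l" using d(1) by simp
        then have "norm (deviation ip \<alpha> js t \<omega>) \<le> K + (d * l + A)"
          using K[of t] A[of "nat \<lfloor>t\<rfloor>"] t
            norm_triangle_sub[of "deviation ip \<alpha> js t \<omega>" "walk (nat \<lfloor>t\<rfloor>) \<omega>"] by auto
        then have "?f t \<le> sqrt b * (K + (d * l + A))"
          using b(1) by (intro order_trans[OF norm_le] mult_left_mono) auto
        also have "\<dots> = sqrt b * (K + A) + sqrt b * d * l" by (simp add: algebra_simps)
        finally show ?thesis by (simp add: d)
      qed
      have "((\<lambda>l::nat. sqrt b * (K + A) / l) \<longlongrightarrow> 0) sequentially" by (rule lim_const_over_n)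
      then have "\<forall>\<^sub>F l::nat in sequentially. sqrt b * (K + A) / l < e / 2"
        by (rule order_tendstoD) (use e in simp)
      with eventually_gt_at_top[of 0]
      show "\<forall>\<^sub>F l::nat in sequentially. dist ((1 / real l) * (SUP t\<in>{0..real l}. ?f t)) 0 < e"
      proof eventually_elim
        case (elim l)
        \<comment> \<open>Boundedness makes the supremum dominate its value at time 0, hence
          nonnegative, so that an upper bound settles the distance to 0.\<close>
        have bdd: "bdd_above (?f ` {0..real l})"
          using f_le[of _ l] by (rule bdd_aboveI2)
        have "(SUP t\<in>{0..real l}. ?f t) \<le> sqrt b * (K + A) + e / 2 * l"
          using f_le[of _ l] by (intro cSUP_least) auto
        then have "(1 / real l) * (SUP t\<in>{0..real l}. ?f t) \<le> (1 / real l) * (sqrt b * (K + A) + e / 2 * l)"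
          by (rule mult_left_mono) simp
        also have "\<dots> = sqrt b * (K + A) / l + e / 2" using elim by (simp add: field_simps)
        also have "\<dots> < e" using elim by linarith
        finally have "(1 / real l) * (SUP t\<in>{0..real l}. ?f t) < e" .
        moreover have "0 \<le> ?f 0" using nonneg by simp
        then have "0 \<le> (SUP t\<in>{0..real l}. ?f t)"
          using cSUP_upper[OF _ bdd, of 0] by (meson atLeastAtMost_iff of_nat_0_le_iff order_refl order_trans)
        ultimately show ?case by simp
      qed
    qed
  qed
qed

text \<open>Links the entrywise covariance matrix with the variance in direction \<open>u\<close>,
  the quantity seen by the central limit theorem. Any \<open>i\<close> is allowed since the
  increments share one law.\<close>

lemma covariance_quadratic_form:
  "u \<bullet> (covariance_matrix M (\<lambda>\<omega>. X 1 \<omega> 1) *v u) = expectation (\<lambda>\<omega>. (u \<bullet> incr i \<omega>)\<^sup>2)"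
proof -
  define d where "d \<eta> = \<eta> 1 - drift 1" for \<eta> :: "real \<Rightarrow> real^'n"
  have mean: "expectation (\<lambda>\<omega>. X 1 \<omega> 1 $ j) = drift 1 $ j" for j
    by (subst expectation_X[of 1 "\<lambda>\<eta>. \<eta> 1 $ j"]) (simp_all add: drift_def)
  have entry: "covariance_matrix M (\<lambda>\<omega>. X 1 \<omega> 1) $ j $ k = (\<Sum>\<eta>\<in>B. p \<eta> * (d \<eta> $ j * d \<eta> $ k))" for j k
    unfolding covariance_matrix_def
    using expectation_X[of 1 "\<lambda>\<eta>. (\<eta> 1 $ j - drift 1 $ j) * (\<eta> 1 $ k - drift 1 $ k)"]
    by (simp add: mean d_def del: One_nat_def)
  have "u \<bullet> (covariance_matrix M (\<lambda>\<omega>. X 1 \<omega> 1) *v u) =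
      (\<Sum>j\<in>UNIV. \<Sum>k\<in>UNIV. \<Sum>\<eta>\<in>B. p \<eta> * ((u $ j * d \<eta> $ j) * (u $ k * d \<eta> $ k)))"
    by (simp add: inner_vec_def matrix_vector_mult_def entry sum_distrib_left sum_distrib_right mult_ac
        del: One_nat_def)
  also have "\<dots> = (\<Sum>j\<in>UNIV. \<Sum>\<eta>\<in>B. \<Sum>k\<in>UNIV. p \<eta> * ((u $ j * d \<eta> $ j) * (u $ k * d \<eta> $ k)))"
    by (intro sum.cong refl sum.swap)
  also have "\<dots> = (\<Sum>\<eta>\<in>B. \<Sum>j\<in>UNIV. \<Sum>k\<in>UNIV. p \<eta> * ((u $ j * d \<eta> $ j) * (u $ k * d \<eta> $ k)))"
    by (rule sum.swap)
  also have "\<dots> = (\<Sum>\<eta>\<in>B. p \<eta> * (u \<bullet> d \<eta>)\<^sup>2)"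
    by (simp add: inner_vec_def power2_eq_square flip: sum_distrib_left sum_distrib_right)
  also have "\<dots> = expectation (\<lambda>\<omega>. (u \<bullet> incr i \<omega>)\<^sup>2)"
    by (simp add: expectation_incr[of "\<lambda>x. (u \<bullet> x)\<^sup>2"] d_def)
  finally show ?thesis .
qed

text \<open>There are two errors: the bounded distance to the walk, divided by
  \<open>sqrt t\<close>, and the change of normalization from \<open>sqrt t\<close> to the root of
  its integer part. For the latter the crude linear bound on the walk is enough.\<close>

lemma deviation_remainder_tendsto:
  assumes bil: "bilinear ip" and pos: "\<And>i. ip (drift 1) (coroot ip (\<alpha> i)) > 0"
  shows "AE \<omega> in M. ((\<lambda>t. (1 / sqrt t) *\<^sub>R deviation ip \<alpha> js t \<omega> -
    walk (nat \<lfloor>t\<rfloor>) \<omega> /\<^sub>R sqrt (real (nat \<lfloor>t\<rfloor>))) \<longlongrightarrow> 0) at_top"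
proof -
  obtain C where "C > 0" and C: "\<And>i \<omega>. \<omega> \<in> space M \<Longrightarrow> norm (incr i \<omega>) \<le> C"
    using incr_bounded by blast
  show ?thesis
    using pitman_word_deviation[where ip = ip and \<alpha> = \<alpha> and js = js, OF bil pos] AE_space
  proof eventually_elim
    case (elim \<omega>)
    obtain K where K: "\<And>t. 0 \<le> t \<Longrightarrow> norm (deviation ip \<alpha> js t \<omega> - walk (nat \<lfloor>t\<rfloor>) \<omega>) \<le> K"
      using elim(1) unfolding deviation_def by blast
    have walk_le: "norm (walk n \<omega>) \<le> real n * C" for n
      using sum_norm_bound[of "{..<n}" "\<lambda>i. incr i \<omega>" C] C[OF elim(2)] by (simp add: walk_def)
    have bound: "norm ((1 / sqrt t) *\<^sub>R deviation ip \<alpha> js t \<omega> - walk (nat \<lfloor>t\<rfloor>) \<omega> /\<^sub>R sqrt (real (nat \<lfloor>t\<rfloor>)))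
        \<le> K / sqrt t + C / sqrt (real (nat \<lfloor>t\<rfloor>))" if t: "t \<ge> 1" for t
    proof -
      define k where "k = nat \<lfloor>t\<rfloor>"
      have k: "real k \<le> t" "t \<le> real k + 1" "1 \<le> real k"
        using t unfolding k_def by (linarith, linarith, simp add: le_nat_iff)
      define a b where "a = sqrt k" and "b = sqrt t"
      have ab: "1 \<le> a" "a \<le> b" "a\<^sup>2 = k" "b\<^sup>2 = t" using k by (simp_all add: a_def b_def)
      \<comment> \<open>Because the squares of \<open>a\<close> and \<open>b\<close> differ by at
        most 1, the gap \<open>1 / a - 1 / b\<close> times \<open>k\<close> is at most
        \<open>1 / a\<close>, which offsets the linear size of the walk.\<close>
      have "(b - a) * a \<le> (b - a) * (b + a)" using ab by (intro mult_left_mono) auto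
      also have "\<dots> = b\<^sup>2 - a\<^sup>2" by (simp add: power2_eq_square algebra_simps)
      also have "\<dots> \<le> 1" using ab k by simp
      finally have "(b - a) * a * a \<le> 1 * a" using ab by (intro mult_right_mono) auto
      with ab have "(b - a) * a * a \<le> b" by linarith
      then have "((b - a) * a * a) / (a * b) \<le> b / (a * b)"
        using ab by (intro divide_right_mono) auto
      then have "(1 / a - 1 / b) * k \<le> 1 / a"
        using ab by (simp add: ab(3)[symmetric] power2_eq_square diff_divide_distrib algebra_simps)
      moreover have "0 \<le> 1 / a - 1 / b" using ab by (simp add: field_simps)
      ultimately have "norm ((1 / b - 1 / a) *\<^sub>R walk k \<omega>) \<le> C / a"
        using mult_left_mono[OF walk_le[of k], of "1 / a - 1 / b"] \<open>C > 0\<close>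
          mult_right_mono[of "(1 / a - 1 / b) * k" "1 / a" C] by (simp add: mult_ac)
      moreover have "norm ((1 / b) *\<^sub>R (deviation ip \<alpha> js t \<omega> - walk k \<omega>)) \<le> K / b"
        using K[of t] t ab by (simp add: k_def divide_right_mono)
      ultimately have "norm ((1 / b) *\<^sub>R (deviation ip \<alpha> js t \<omega> - walk k \<omega>) + (1 / b - 1 / a) *\<^sub>R walk k \<omega>)
          \<le> K / b + C / a"
        by (intro norm_triangle_mono)
      also have "(1 / b) *\<^sub>R (deviation ip \<alpha> js t \<omega> - walk k \<omega>) + (1 / b - 1 / a) *\<^sub>R walk k \<omega> =
          (1 / b) *\<^sub>R deviation ip \<alpha> js t \<omega> - walk k \<omega> /\<^sub>R a"
        by (simp add: algebra_simps divide_inverse)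
      finally show ?thesis by (simp add: a_def b_def k_def)
    qed
    have "filterlim (\<lambda>t. sqrt (real (nat \<lfloor>t\<rfloor>))) at_top at_top"
      by (intro filterlim_compose[OF sqrt_at_top] filterlim_compose[OF filterlim_real_sequentially]
          filterlim_compose[OF filterlim_nat_sequentially] filterlim_floor_sequentially)
    then have "((\<lambda>t. K / sqrt t + C / sqrt (real (nat \<lfloor>t\<rfloor>))) \<longlongrightarrow> 0 + 0) at_top"
      by (intro tendsto_add tendsto_divide_0[OF tendsto_const] filterlim_at_top_imp_at_infinity sqrt_at_top)
    then show ?case
      by (intro Lim_null_comparison[OF eventually_mono[OF eventually_ge_at_top[of 1] bound]]) auto
  qed
qed

lemma deviation_converges_in_law:
  assumes bil: "bilinear ip" and pos: "\<And>i. ip (drift 1) (coroot ip (\<alpha> i)) > 0"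
  shows "\<exists>N. centered_gaussian (covariance_matrix M (\<lambda>\<omega>. X 1 \<omega> 1)) N \<and>
    converges_in_law M (\<lambda>t \<omega>. (1 / sqrt t) *\<^sub>R deviation ip \<alpha> js t \<omega>) at_top N"
proof -
  let ?\<Gamma> = "covariance_matrix M (\<lambda>\<omega>. X 1 \<omega> 1)"
  \<comment> \<open>Weighting each centered endpoint by \<open>sqrt (p \<eta>)\<close> writes the
    covariance form as a finite sum of squares, the shape expected by the Gaussian
    construction.\<close>
  have variance: "(\<Sum>\<eta>\<in>B. (u \<bullet> (sqrt (p \<eta>) *\<^sub>R (\<eta> 1 - drift 1)))\<^sup>2) = u \<bullet> (?\<Gamma> *v u)" for u
    by (simp add: covariance_quadratic_form[of _ 0] expectation_incr[of "\<lambda>x. (u \<bullet> x)\<^sup>2"]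
        power_mult_distrib p_nonneg del: One_nat_def)
  obtain N where N: "prob_space N" "sets N = sets borel"
    and normal: "\<And>u. distr N borel (\<lambda>x. u \<bullet> x) =
      (if u \<bullet> (?\<Gamma> *v u) = 0 then return borel 0
       else density lborel (normal_density 0 (sqrt (u \<bullet> (?\<Gamma> *v u)))))"
    using centered_gaussian_exists[OF finite_paths, of "\<lambda>\<eta>. sqrt (p \<eta>) *\<^sub>R (\<eta> 1 - drift 1)"]
    unfolding variance by blast
  obtain C where "C > 0" and "\<And>i \<omega>. \<omega> \<in> space M \<Longrightarrow> norm (incr i \<omega>) \<le> C"
    using incr_bounded by blast
  then have bound: "AE \<omega> in M. norm (incr i \<omega>) \<le> C" for i by simp
  \<comment> \<open>Normalized by the integer part of the time, \<open>Z\<close> is the discrete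
    central limit sequence composed with the floor.\<close>
  define Z where "Z t \<omega> = walk (nat \<lfloor>t\<rfloor>) \<omega> /\<^sub>R sqrt (real (nat \<lfloor>t\<rfloor>))" for t :: real and \<omega>
  have [measurable]: "Z t \<in> borel_measurable M" for t unfolding Z_def by measurable
  have floor: "filterlim (\<lambda>t::real. nat \<lfloor>t\<rfloor>) sequentially at_top"
    by (intro filterlim_compose[OF filterlim_nat_sequentially] filterlim_floor_sequentially)
  have "converges_in_law M (\<lambda>t \<omega>. Z t \<omega> + ((1 / sqrt t) *\<^sub>R deviation ip \<alpha> js t \<omega> - Z t \<omega>)) at_top N"
  proof (rule converges_in_law_perturb[OF N])
    fix u
    have "(\<lambda>n. CLINT \<omega>|M. iexp (u \<bullet> (walk n \<omega> /\<^sub>R sqrt n))) \<longlonglongrightarrow> (CLINT x|N. iexp (u \<bullet> x))"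
      unfolding walk_def
      by (rule char_normalized_sum_tendsto[OF incr_indep bound incr_mean distr_incr N(2)])
        (rule normal[of u, unfolded covariance_quadratic_form[of _ 0]])
    from filterlim_compose[OF this floor]
    show "((\<lambda>t. CLINT \<omega>|M. iexp (u \<bullet> Z t \<omega>)) \<longlongrightarrow> (CLINT x|N. iexp (u \<bullet> x))) at_top"
      unfolding Z_def .
  next
    fix e :: real assume "e > 0"
    then obtain R where R: "\<And>n. n > 0 \<Longrightarrow> prob {\<omega> \<in> space M. norm (walk n \<omega> /\<^sub>R sqrt n) > R} \<le> e"
      unfolding walk_def using bounded_sum_tight[OF incr_indep bound \<open>C > 0\<close> incr_mean] by blast
    \<comment> \<open>The uniform tail bound is stated for positive \<open>n\<close>, which the
      integer part of \<open>t\<close> eventually is.\<close>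
    have "\<forall>\<^sub>F t in at_top. 1 \<le> nat \<lfloor>t::real\<rfloor>"
      using floor unfolding filterlim_at_top by blast
    then have "\<forall>\<^sub>F t in at_top. prob {\<omega> \<in> space M. norm (Z t \<omega>) > R} \<le> e"
      unfolding Z_def by eventually_elim (rule R, linarith)
    then show "\<exists>R. \<forall>\<^sub>F t in at_top. prob {\<omega> \<in> space M. norm (Z t \<omega>) > R} \<le> e" by blast
  next
    show "AE \<omega> in M. ((\<lambda>t. (1 / sqrt t) *\<^sub>R deviation ip \<alpha> js t \<omega> - Z t \<omega>) \<longlongrightarrow> 0) at_top"
      using deviation_remainder_tendsto[where ip = ip and \<alpha> = \<alpha> and js = js, OF bil pos] unfolding Z_def .
  qed measurable
  then have "converges_in_law M (\<lambda>t \<omega>. (1 / sqrt t) *\<^sub>R deviation ip \<alpha> js t \<omega>) at_top N" by simp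
  moreover have "centered_gaussian ?\<Gamma> N"
    unfolding centered_gaussian_def using N normal by blast
  ultimately show ?thesis by blast
qed

end

section \<open>Application to the Littelmann crystal\<close>

theorem theorem5p4:
  fixes scale :: "complex \<Rightarrow> 'g::ab_group_add \<Rightarrow> 'g"
    and br :: "'g \<Rightarrow> 'g \<Rightarrow> 'g"
    and H :: "'g set"
    and \<iota> :: "real^'n \<Rightarrow> 'g \<Rightarrow> complex"
    and ip :: "real^'n \<Rightarrow> real^'n \<Rightarrow> real"
    and \<alpha> :: "'n::finite \<Rightarrow> real^'n"
    and \<kappa> \<tau> :: "real^'n"
    and \<pi>\<^sub>\<kappa> :: "real \<Rightarrow> real^'n"
    and M :: "'w measure"
    and X :: "nat \<Rightarrow> 'w \<Rightarrow> real \<Rightarrow> real^'n"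
    and w\<^sub>0 :: "real^'n \<Rightarrow> real^'n"
    and js :: "'n list"
  assumes lie: "realized_simple_lie_algebra scale br H \<iota> ip \<alpha>"
    and \<kappa>: "\<kappa> \<in> dominant_weights ip \<alpha>"
    and path: "elementary_path ip \<alpha> \<pi>\<^sub>\<kappa>" "\<pi>\<^sub>\<kappa> 1 = \<kappa>" "\<pi>\<^sub>\<kappa> ` {0..1} \<subseteq> weyl_chamber ip \<alpha>"
    and \<tau>: "\<And>i. \<tau> $ i > 0"
    and M: "prob_space M"
    and X_indep: "prob_space.indep_vars M (\<lambda>_. count_space (littelmann_crystal ip \<alpha> \<pi>\<^sub>\<kappa>)) X {1..}"
    and X_law: "\<And>l. l \<ge> 1 \<Longrightarrow>
      distributed M (count_space (littelmann_crystal ip \<alpha> \<pi>\<^sub>\<kappa>)) (X l)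
        (\<lambda>\<eta>. ennreal (path_prob ip \<alpha> \<pi>\<^sub>\<kappa> \<tau> \<eta>))"
    and w\<^sub>0: "is_longest_element ip \<alpha> w\<^sub>0" "reduced_word_of ip \<alpha> w\<^sub>0 js"
    and drift: "drift_path ip \<alpha> \<pi>\<^sub>\<kappa> \<tau> 1 \<in> dominant_drift_set ip \<alpha> \<pi>\<^sub>\<kappa>"
  shows "let m = drift_path ip \<alpha> \<pi>\<^sub>\<kappa> \<tau>;
             \<W> = (\<lambda>\<omega>. concat_paths (\<lambda>l. X l \<omega>));
             \<H> = (\<lambda>\<omega>. pitman_word ip \<alpha> js (\<W> \<omega>));
             D = (\<lambda>t \<omega>. \<H> \<omega> t - periodic_drift m t)
         in (AE \<omega> in M.
               (\<lambda>l::nat. (1 / real l) * (SUP t\<in>{0..real l}. sqrt (ip (D t \<omega>) (D t \<omega>)))) \<longlonglongrightarrow> 0) \<and>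
            (\<exists>N. centered_gaussian (covariance_matrix M (\<lambda>\<omega>. X 1 \<omega> 1)) N \<and>
                 converges_in_law M (\<lambda>t \<omega>. (1 / sqrt t) *\<^sub>R D t \<omega>) at_top N)"
proof -
  define B where "B = littelmann_crystal ip \<alpha> \<pi>\<^sub>\<kappa>"
  define p where "p = path_prob ip \<alpha> \<pi>\<^sub>\<kappa> \<tau>"
  interpret prob_space M by (rule M)
  have sp: "scalar_product ip" and indep\<alpha>: "independent (range \<alpha>)"
    using lie by (simp_all add: realized_simple_lie_algebra_def realized_simple_lie_algebra_axioms_def)
  have bil: "bilinear ip" using sp by (simp add: scalar_product_def)
  have nz: "\<alpha> i \<noteq> 0" for i using indep\<alpha> dependent_zero by (metis rangeI)
  have "bounded (\<pi>\<^sub>\<kappa> ` {0..1})"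
    using path(1) unfolding elementary_path_def
    by (intro compact_imp_bounded compact_continuous_image) auto
  then have bounded: "bounded (\<eta> ` {0..1})" if "\<eta> \<in> B" for \<eta>
    using littelmann_crystal_bounded[OF bil] that unfolding B_def by blast
  \<comment> \<open>Over an infinite crystal the sum of weights is 0 by convention, and division by
    0 gives 0. All probabilities would vanish and the law of \<open>X 1\<close> would have total
    mass 0.\<close>
  have finite: "finite B"
  proof (rule ccontr)
    assume "infinite B"
    then have "p \<eta> = 0" for \<eta>
      by (simp add: p_def path_prob_def crystal_sum_def B_def)
    then have zero: "distr M (count_space B) (X 1) = density (count_space B) (\<lambda>_. 0)"
      using distributed_distr_eq_density[OF X_law[of 1]] by (simp add: p_def B_def)
    have "prob_space (distr M (count_space B) (X 1))"
      using distributed_measurable[OF X_law[of 1]] by (intro prob_space_distr) (simp add: B_def)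
    then show False
      unfolding zero using prob_space.emeasure_space_1 by (fastforce simp: emeasure_density)
  qed
  have "0 \<le> tau_pow \<alpha> \<tau> b" for b
    unfolding tau_pow_def by (intro prod_nonneg) simp
  then have "0 \<le> p \<eta>" for \<eta>
    by (simp add: p_def path_prob_def crystal_sum_def sum_nonneg)
  then interpret random_path M B p X
    using finite bounded X_indep X_law by unfold_locales (auto simp: B_def p_def)
  have drift_eq: "drift_path ip \<alpha> \<pi>\<^sub>\<kappa> \<tau> = drift"
    unfolding drift_path_def drift_def by (simp add: B_def p_def)
  have pos: "ip (drift 1) (coroot ip (\<alpha> i)) > 0" for i
    using interior_weyl_chamber_pos[where \<alpha> = \<alpha>, OF sp nz] drift
    by (simp add: dominant_drift_set_def drift_eq)
  show ?thesis
    using deviation_sup_tendsto[where \<alpha> = \<alpha> and js = js, OF sp pos]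
      deviation_converges_in_law[where \<alpha> = \<alpha> and js = js, OF bil pos]
    unfolding Let_def drift_eq deviation_def by blast
qed

end
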